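(* Let $\sigma=\{\sigma_z\}_{z\in\mathbb{Z}}$ be i.i.d. strictly positive random variables with law $\mathbf{P}$, and suppose $L(x):=1/\mathbf{P}(\sigma_0>x)$ is slowly varying at infinity, i.e. $\lim_{u\to\infty}L(uv)/L(u)=1$ for every $v>0$. Let $\{X_s\}_{s\ge0}$ be the Bouchaud trap model in the landscape $\sigma$ started at $X_0=0$, with quenched law $P_\sigma$. Then for $i=1,2$, as $t\to\infty$, \[ P_\sigma\big(X_t=Z^{(i)}_t\big)+\frac{|Z^{(i)}_t|}{\sum_{z\in\Gamma_t}|z|}\to 1\quad\text{in }\mathbf{P}\text{-probability}.\]
   Context: The Bouchaud trap model (BTM) in the landscape $\sigma$ is the continuous-time Markov chain on $\mathbb{Z}$ with transition rates $w_{z\to y}=\frac{1}{2\sigma_z}$ if $|z-y|=1$ and $0$ otherwise; $P_\sigma$ denotes its law given $\sigma$ with $X_0=0$. Define $\ell_t:=\min\{s\ge0: sL(s)\ge t\}$, $Z^{(1)}_t:=\min\{z\in\mathbb{Z}^+:\sigma_z>\ell_t\}$, $Z^{(2)}_t:=\max\{z\in\mathbb{Z}^-:\sigma_z>\ell_t\}$ (with $\mathbb{Z}^+$ the positive and $\mathbb{Z}^-$ the non-positive integers), and $\Gamma_t:=\{Z^{(1)}_t,Z^{(2)}_t\}$. *)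

theory Defs
  imports "HOL-Probability.Probability"
begin

text \<open>Quenched law of the Bouchaud trap model (BTM) on the integers in landscape s,
  started at 0, via the jump-chain / holding-time construction of the (minimal)
  continuous-time Markov chain with rates w(z -> z+-1) = 1/(2 s z).
  The embedded jump chain is simple symmetric random walk; the holding time at
  site z is exponential with rate 1/(s z) (mean s z).\<close>

definition nn_steps :: "nat \<Rightarrow> int list set" where
  "nn_steps n = {ds. set ds \<subseteq> {-1, 1} \<and> length ds = n}"

definition path_pos :: "int list \<Rightarrow> nat \<Rightarrow> int" where
  "path_pos ds k = sum_list (take k ds)"

text \<open>Probability that, along the visited sites x 0, ..., x n, with independent
  exponential holding times of rates 1/(s (x k)), exactly n jumps occurred by time t.\<close>
definition hold_prob :: "(int \<Rightarrow> real) \<Rightarrow> (nat \<Rightarrow> int) \<Rightarrow> nat \<Rightarrow> real \<Rightarrow> real" where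
  "hold_prob s x n t =
     measure (PiM {..n} (\<lambda>k. density lborel (exponential_density (1 / s (x k)))))
       {T \<in> space (PiM {..n} (\<lambda>k. density lborel (exponential_density (1 / s (x k))))).
          (\<Sum>k<n. T k) \<le> t \<and> t < (\<Sum>k\<le>n. T k)}"

definition BTM_prob :: "(int \<Rightarrow> real) \<Rightarrow> real \<Rightarrow> int \<Rightarrow> real" where
  "BTM_prob s t y =
     (\<Sum>n. \<Sum>ds\<in>nn_steps n.
        if sum_list ds = y then (1/2) ^ n * hold_prob s (path_pos ds) n t else 0)"

definition slowly_varying :: "(real \<Rightarrow> real) \<Rightarrow> bool" where
  "slowly_varying L \<longleftrightarrow> (\<forall>v>0. ((\<lambda>u. L (u * v) / L u) \<longlongrightarrow> 1) at_top)"

text \<open>ell_t = min {s >= 0 : s L(s) >= t} (the minimum is attained since s L(s) is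
  nondecreasing and right-continuous; we write it as an infimum).\<close>
definition ell :: "(real \<Rightarrow> real) \<Rightarrow> real \<Rightarrow> real" where
  "ell L t = Inf {s. 0 \<le> s \<and> t \<le> s * L s}"

definition Z1 :: "(int \<Rightarrow> real) \<Rightarrow> real \<Rightarrow> int" where
  "Z1 s l = int (LEAST n::nat. 0 < n \<and> l < s (int n))"

definition Z2 :: "(int \<Rightarrow> real) \<Rightarrow> real \<Rightarrow> int" where
  "Z2 s l = - int (LEAST n::nat. l < s (- int n))"

definition Gamma_set :: "(int \<Rightarrow> real) \<Rightarrow> real \<Rightarrow> int set" where
  "Gamma_set s l = {Z1 s l, Z2 s l}"

text \<open>Convergence in probability, phrased via inner measurable sets so that it is not
  vacuous in case of non-measurability: for all eps, delta > 0, eventually there is an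
  event of probability >= 1 - delta on which |Y t - c| <= eps.\<close>
definition conv_in_prob :: "'a measure \<Rightarrow> (real \<Rightarrow> 'a \<Rightarrow> real) \<Rightarrow> real \<Rightarrow> bool" where
  "conv_in_prob M Y c \<longleftrightarrow>
     (\<forall>\<epsilon>>0. \<forall>\<delta>>0. eventually (\<lambda>t. \<exists>A\<in>sets M. measure M A \<ge> 1 - \<delta> \<and>
         (\<forall>\<omega>\<in>A. \<bar>Y t \<omega> - c\<bar> \<le> \<epsilon>)) at_top)"

end

theory Submission
  imports Defs
begin

text \<open>
  Since the probabilities of sitting in the two traps add up to at most 1, lower bounds for both
  suffice. Summing over the jump paths shows that \<open>u(t, x) = P\<^sub>x(X\<^sub>t \<in> Y)\<close> solves the backward
  equation. For \<open>Y = {Z}\<close>, pairing \<open>u\<close> with \<open>\<sigma>\<close> times a tent function of radius \<open>a\<close> around \<open>Z\<close>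
  gives \<open>u(t, Z) \<ge> 1 - t / (a \<sigma>\<^sub>Z) - (\<Sum>x. \<sigma>\<^sub>x) / \<sigma>\<^sub>Z\<close>, the sum over the other sites within
  distance \<open>a\<close>: a walk started in a deep trap stays there. Between the two traps \<open>u\<close> is compared with
  the linear (harmonic) interpolation minus an exponentially decaying barrier, which yields the
  exit probabilities as soon as \<open>t\<close> is large compared to the width of the interval times the total
  depth inside. With high probability the landscape is such that all error terms are small: on the
  scale \<open>L(l)\<close> the two traps exceed \<open>K l\<close>, no trap lies between \<open>\<eta> l\<close> and \<open>K l\<close> by slow variation,
  traps above \<open>l\<close> are at distance at least \<open>\<delta> L(l)\<close> from each other, and those below \<open>\<eta> l\<close> have a
  total depth that is small compared to \<open>l\<close>.
\<close>

subsection \<open>Path expansion and the backward equation\<close>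

abbreviation holding :: "(int \<Rightarrow> real) \<Rightarrow> int \<Rightarrow> real measure" where
  "holding s z \<equiv> density lborel (exponential_density (1 / s z))"

lemma hold_prob_nonneg: "0 \<le> hold_prob s x n t"
  unfolding hold_prob_def by simp

locale landscape =
  fixes s :: "int \<Rightarrow> real"
  assumes pos: "\<And>z. 0 < s z"
begin

lemma prob_space_holding: "prob_space (holding s z)"
  by (intro prob_space_exponential_density) (simp add: pos)

lemma hold_prob_sets:
  fixes n :: nat
  shows "{T \<in> space (PiM {..n} (\<lambda>k. holding s (x k))). (\<Sum>k<n. T k) \<le> t \<and> t < (\<Sum>k\<le>n. T k)}
     \<in> sets (PiM {..n} (\<lambda>k. holding s (x k)))"
  by measurable

text \<open>Conditioning on the first holding time: Fubini splits coordinate 0 off the product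
  measure, and the remaining times belong to the path shifted by one step. The nonnegative integral
  is used because regularity of the integrand in \<open>r\<close> is only established further
  below.\<close>

lemma hold_prob_Suc_nn:
  shows "ennreal (hold_prob s x (Suc n) t) =
    (\<integral>\<^sup>+ r. ennreal (hold_prob s (\<lambda>k. x (Suc k)) n (t - r)) \<partial>holding s (x 0))"
proof -
  let ?D = "\<lambda>k. holding s (x k)"
  have ps: "prob_space (?D k)" for k
    by (rule prob_space_holding)
  interpret product_sigma_finite ?D
    by (intro product_sigma_finite.intro prob_space_imp_sigma_finite ps)
  define A where "A = {T \<in> space (PiM {..Suc n} ?D). (\<Sum>k<Suc n. T k) \<le> t \<and> t < (\<Sum>k\<le>Suc n. T k)}"
  define B where "B r = {T \<in> space (PiM {..n} (\<lambda>k. ?D (Suc k))).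
     (\<Sum>k<n. T k) \<le> t - r \<and> t - r < (\<Sum>k\<le>n. T k)}" for r
  have A: "A \<in> sets (PiM {..Suc n} ?D)"
    unfolding A_def by (rule hold_prob_sets)
  have B: "B r \<in> sets (PiM {..n} (\<lambda>k. ?D (Suc k)))" for r
    unfolding B_def by (rule hold_prob_sets[of n "\<lambda>k. x (Suc k)"])
  have I: "{..Suc n} = insert 0 (Suc ` {..n})"
    by (rule atMost_Suc_eq_insert_0)
  have psP: "prob_space (PiM {..Suc n} ?D)"
    by (rule prob_space_PiM) (rule ps)
  have psQ: "prob_space (PiM {..n} (\<lambda>k. ?D (Suc k)))"
    by (rule prob_space_PiM) (rule ps)
  \<comment> \<open>Relabels the coordinates 1, ..., n+1 as 0, ..., n.\<close>
  have re: "distr (PiM (Suc ` {..n}) ?D) (PiM {..n} (\<lambda>k. ?D (Suc k))) (\<lambda>w. \<lambda>k\<in>{..n}. w (Suc k))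
     = PiM {..n} (\<lambda>k. ?D (Suc k))"
    by (rule distr_PiM_reindex) (use ps in auto)
  have "ennreal (hold_prob s x (Suc n) t) = emeasure (PiM {..Suc n} ?D) A"
    unfolding hold_prob_def A_def
    using finite_measure.emeasure_eq_measure[OF prob_space.finite_measure[OF psP]] by simp
  also have "\<dots> = (\<integral>\<^sup>+ T. indicator A T \<partial>PiM (insert 0 (Suc ` {..n})) ?D)"
    using A I by simp
  also have "\<dots> = (\<integral>\<^sup>+ r. (\<integral>\<^sup>+ T. indicator A (T(0 := r)) \<partial>PiM (Suc ` {..n}) ?D) \<partial>?D 0)"
  proof (rule product_nn_integral_insert_rev)
    show "(\<lambda>T. indicator A T) \<in> borel_measurable (PiM (insert 0 (Suc ` {..n})) ?D)"
      using A I by simp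
  qed auto
  also have "\<dots> = (\<integral>\<^sup>+ r. ennreal (hold_prob s (\<lambda>k. x (Suc k)) n (t - r)) \<partial>?D 0)"
  proof (rule nn_integral_cong)
    fix r
    have "(\<integral>\<^sup>+ T. indicator A (T(0 := r)) \<partial>PiM (Suc ` {..n}) ?D)
       = (\<integral>\<^sup>+ T. indicator (B r) (\<lambda>k\<in>{..n}. T (Suc k)) \<partial>PiM (Suc ` {..n}) ?D)"
    proof (rule nn_integral_cong)
      fix T assume T: "T \<in> space (PiM (Suc ` {..n}) ?D)"
      have "T(0 := r) \<in> A \<longleftrightarrow> (\<lambda>k\<in>{..n}. T (Suc k)) \<in> B r"
      proof -
        let ?T = "T(0 := r)" and ?T' = "\<lambda>k\<in>{..n}. T (Suc k)"
        have "?T \<in> space (PiM {..Suc n} ?D)"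
          using T unfolding I space_PiM by (intro PiE_fun_upd) auto
        moreover have "?T' \<in> space (PiM {..n} (\<lambda>k. ?D (Suc k)))"
          by (simp add: space_PiM)
        moreover have S1: "(\<Sum>k<Suc n. ?T k) = r + (\<Sum>k<n. ?T' k)"
          unfolding sum.lessThan_Suc_shift by simp
        moreover have S2: "(\<Sum>k\<le>Suc n. ?T k) = r + (\<Sum>k\<le>n. ?T' k)"
          unfolding sum.atMost_Suc_shift by simp
        ultimately show ?thesis
          unfolding A_def B_def mem_Collect_eq S1 S2 le_diff_eq diff_less_eq by (simp add: add.commute)
      qed
      then show "indicator A (T(0 := r)) = (indicator (B r) (\<lambda>k\<in>{..n}. T (Suc k)) :: ennreal)"
        by (auto simp: indicator_def)
    qed
    also have "\<dots> = (\<integral>\<^sup>+ w. indicator (B r) w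
        \<partial>distr (PiM (Suc ` {..n}) ?D) (PiM {..n} (\<lambda>k. ?D (Suc k))) (\<lambda>w. \<lambda>k\<in>{..n}. w (Suc k)))"
      using B by (subst nn_integral_distr) (auto intro!: measurable_restrict measurable_component_singleton)
    also have "\<dots> = emeasure (PiM {..n} (\<lambda>k. ?D (Suc k))) (B r)"
      unfolding re using B by simp
    also have "\<dots> = ennreal (hold_prob s (\<lambda>k. x (Suc k)) n (t - r))"
      unfolding hold_prob_def B_def
      using finite_measure.emeasure_eq_measure[OF prob_space.finite_measure[OF psQ]] by simp
    finally show "(\<integral>\<^sup>+ T. indicator A (T(0 := r)) \<partial>PiM (Suc ` {..n}) ?D)
       = ennreal (hold_prob s (\<lambda>k. x (Suc k)) n (t - r))" .
  qed
  finally show ?thesis .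
qed

text \<open>Holding times are almost surely nonnegative. Vanishing at negative times is what cuts
  the convolution integral over the real line down to \<open>{0..t}\<close>.\<close>

lemma hold_prob_neg:
  assumes "t < 0"
  shows "hold_prob s x n t = 0"
  using assms
proof (induction n arbitrary: x t)
  case 0
  then show ?case by (simp add: hold_prob_def)
next
  case (Suc n)
  have "ennreal (hold_prob s x (Suc n) t) = (\<integral>\<^sup>+ r. 0 \<partial>holding s (x 0))"
    unfolding hold_prob_Suc_nn
  proof (rule nn_integral_cong_AE)
    show "AE r in holding s (x 0). ennreal (hold_prob s (\<lambda>k. x (Suc k)) n (t - r)) = 0"
      using Suc by (subst AE_density) (auto simp: exponential_density_def intro!: AE_I2)
  qed
  then show ?case using hold_prob_nonneg[of s x "Suc n" t] by simp
qed

lemma hold_prob_0: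
  assumes "0 \<le> t"
  shows "hold_prob s x 0 t = exp (- t / s (x 0))"
proof -
  let ?D = "\<lambda>k. holding s (x k)"
  have ps: "prob_space (?D k)" for k
    by (rule prob_space_holding)
  interpret product_sigma_finite ?D
    by (intro product_sigma_finite.intro prob_space_imp_sigma_finite ps)
  interpret D: prob_space "?D 0" by (rule ps)
  have [simp]: "{..0::nat} = {0}" by auto
  have psP: "prob_space (PiM {0::nat} ?D)" by (rule prob_space_PiM) (rule ps)
  have "ennreal (hold_prob s x 0 t) = emeasure (PiM {0} ?D) {T \<in> space (PiM {0} ?D). t < T 0}"
    unfolding hold_prob_def
    using finite_measure.emeasure_eq_measure[OF prob_space.finite_measure[OF psP]] assms by simp
  also have "\<dots> = (\<integral>\<^sup>+ T. indicator {r. t < r} (T 0) \<partial>PiM {0} ?D)"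
  proof (subst nn_integral_indicator[symmetric])
    show "(\<integral>\<^sup>+ T. indicator {T \<in> space (PiM {0} ?D). t < T 0} T \<partial>PiM {0} ?D)
      = (\<integral>\<^sup>+ T. indicator {r. t < r} (T 0) \<partial>PiM {0} ?D)"
      by (rule nn_integral_cong) (simp add: indicator_def)
  qed (measurable; simp)
  also have "\<dots> = (\<integral>\<^sup>+ r. indicator {r. t < r} r \<partial>?D 0)"
    by (subst product_nn_integral_singleton) auto
  also have "\<dots> = emeasure (?D 0) {r \<in> space (?D 0). t < r}"
    by simp
  also have "\<dots> = ennreal (exp (- t / s (x 0)))"
  proof -
    have "D.prob {r \<in> space (?D 0). t < r} = exp (- t * (1 / s (x 0)))"
      using D.exponential_distributedD_gt[of "\<lambda>r. r" "1 / s (x 0)" t] assms pos[of "x 0"]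
      by (simp add: distributed_def distr_id2)
    then show ?thesis by (simp add: D.emeasure_eq_measure)
  qed
  finally show ?thesis using hold_prob_nonneg[of s x 0 t] by simp
qed

end

lemma continuous_on_atLeast:
  fixes f :: "real \<Rightarrow> 'b::topological_space"
  assumes "\<And>b. continuous_on {a..b} f"
  shows "continuous_on {a..} f"
  unfolding continuous_on_eq_continuous_within
proof
  fix x assume "x \<in> {a..}"
  then have "continuous (at x within {a..x+1}) f"
    using assms[of "x+1"] by (simp add: continuous_on_eq_continuous_within)
  moreover have "at x within {a..} = at x within {a..x+1}"
    by (rule at_within_nhd[of x "{..<x+1}"]) auto
  ultimately show "continuous (at x within {a..}) f" by simp
qed

text \<open>The contribution of the paths with exactly \<open>n\<close> jumps to P_x(X_t in Y). The
  start \<open>x\<close> varies because a first-step decomposition moves it; a target set allows the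
  probabilities of both traps to be added.\<close>

definition jump_part :: "(int \<Rightarrow> real) \<Rightarrow> int set \<Rightarrow> nat \<Rightarrow> real \<Rightarrow> int \<Rightarrow> real" where
  "jump_part s Y n t x = (\<Sum>ds\<in>nn_steps n.
     if x + sum_list ds \<in> Y then (1/2) ^ n * hold_prob s (\<lambda>k. x + path_pos ds k) n t else 0)"

lemma nn_steps_0: "nn_steps 0 = {[]}"
  by (auto simp: nn_steps_def)

lemma nn_steps_Suc: "nn_steps (Suc n) = (\<lambda>ds. 1 # ds) ` nn_steps n \<union> (\<lambda>ds. -1 # ds) ` nn_steps n"
  by (auto simp: nn_steps_def length_Suc_conv)

lemma finite_nn_steps: "finite (nn_steps n)"
  by (induction n) (auto simp: nn_steps_0 nn_steps_Suc)

lemma jump_part_nonneg: "0 \<le> jump_part s Y n t x"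
  unfolding jump_part_def by (auto intro!: sum_nonneg simp: hold_prob_nonneg)

section \<open>Recursion in the number of jumps\<close>

context landscape
begin

text \<open>The factor \<open>exp (t / s (x 0))\<close> removes \<open>t\<close> from the integrand
  of the convolution with the exponential density. What remains is an indefinite integral, so
  regularity in \<open>t\<close> comes from that of the integrand.\<close>

lemma hold_prob_Suc:
  assumes "0 \<le> t"
    and cont: "continuous_on {0..} (hold_prob s (\<lambda>k. x (Suc k)) n)"
  shows "exp (t / s (x 0)) * hold_prob s x (Suc n) t =
    integral {0..t} (\<lambda>r. exp (r / s (x 0)) / s (x 0) * hold_prob s (\<lambda>k. x (Suc k)) n r)"
proof -
  let ?g = "hold_prob s (\<lambda>k. x (Suc k)) n" and ?l = "1 / s (x 0)"
  have l: "0 < ?l" using pos by simp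
  let ?h = "\<lambda>r. ?l * exp (- ?l * (t - r)) * ?g r"
  have cg: "continuous_on {0..t} ?g"
    using cont by (rule continuous_on_subset) auto
  have ch: "continuous_on {0..t} ?h"
    by (intro continuous_intros cg)
  \<comment> \<open>Continuity on the half-line yields measurability on the whole line, since the
    function is zero at negative times.\<close>
  have "(\<lambda>r. indicator {0..} r *\<^sub>R ?g r) \<in> borel_measurable borel"
    by (rule borel_measurable_continuous_on_indicator[OF _ cont]) auto
  also have "(\<lambda>r. indicator {0..} r *\<^sub>R ?g r) = ?g"
    using hold_prob_neg by (auto simp: fun_eq_iff indicator_def)
  finally have [measurable]: "?g \<in> borel_measurable borel" .
  have mh: "(\<lambda>r. if r \<in> {0..t} then ?h r else 0) \<in> borel_measurable borel"
    by measurable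
  have "ennreal (hold_prob s x (Suc n) t) = (\<integral>\<^sup>+ r. ennreal (exponential_density ?l r) * ennreal (?g (t - r)) \<partial>lborel)"
    unfolding hold_prob_Suc_nn by (subst nn_integral_density) auto
  also have "\<dots> = (\<integral>\<^sup>+ r. ennreal (exponential_density ?l (t - r)) * ennreal (?g r) \<partial>lborel)"
    \<comment> \<open>The reflection of \<open>r\<close> into \<open>t - r\<close> moves
      \<open>t\<close> from the unknown function into the density.\<close>
    by (subst nn_integral_real_affine[where c="-1" and t=t]) auto
  also have "\<dots> = (\<integral>\<^sup>+ r. ennreal (if r \<in> {0..t} then ?h r else 0) \<partial>lborel)"
  proof (rule nn_integral_cong)
    fix r
    show "ennreal (exponential_density ?l (t - r)) * ennreal (?g r) = ennreal (if r \<in> {0..t} then ?h r else 0)"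
      using l hold_prob_nonneg[of s "\<lambda>k. x (Suc k)" n r] hold_prob_neg[of r]
      by (auto simp: exponential_density_def ennreal_mult[symmetric] mult_ac diff_divide_distrib)
  qed
  also have "\<dots> = ennreal (integral {0..t} ?h)"
  proof (rule nn_integral_has_integral_lborel[OF mh])
    show "0 \<le> (if r \<in> {0..t} then ?h r else 0)" for r
      using l hold_prob_nonneg by (auto intro!: mult_nonneg_nonneg)
    show "((\<lambda>r. if r \<in> {0..t} then ?h r else 0) has_integral integral {0..t} ?h) UNIV"
      unfolding has_integral_restrict_UNIV
      by (rule integrable_integral[OF integrable_continuous_real[OF ch]])
  qed
  finally have E: "ennreal (hold_prob s x (Suc n) t) = ennreal (integral {0..t} ?h)" .
  have "0 \<le> ?h r" for r
    using l hold_prob_nonneg by (intro mult_nonneg_nonneg) auto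
  then have "0 \<le> integral {0..t} ?h"
    by (intro integral_nonneg integrable_continuous_real ch)
  with E have "hold_prob s x (Suc n) t = integral {0..t} ?h"
    using hold_prob_nonneg by (simp add: ennreal_inj)
  then have "exp (t / s (x 0)) * hold_prob s x (Suc n) t = integral {0..t} (\<lambda>r. exp (t / s (x 0)) * ?h r)"
    by simp
  also have "\<dots> = integral {0..t} (\<lambda>r. exp (r / s (x 0)) / s (x 0) * ?g r)"
  proof (rule integral_cong)
    fix r
    have "exp (t / s (x 0)) * exp (- ?l * (t - r)) = exp (r / s (x 0))"
      using pos[of "x 0"] by (simp add: exp_add[symmetric] field_simps)
    moreover have "exp (t / s (x 0)) * ?h r = (exp (t / s (x 0)) * exp (- ?l * (t - r))) * (?l * ?g r)"
      by (simp only: mult_ac)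
    ultimately show "exp (t / s (x 0)) * ?h r = exp (r / s (x 0)) / s (x 0) * ?g r"
      by simp
  qed
  finally show ?thesis .
qed

text \<open>The integral formula for \<open>Suc n\<close> presupposes continuity for
  \<open>n\<close> and returns an indefinite integral, so the induction closes.\<close>

lemma continuous_on_hold_prob:
  shows "continuous_on {0..} (hold_prob s x n)"
proof (induction n arbitrary: x)
  case 0
  have "continuous_on {0..} (\<lambda>t. exp (- t / s (x 0)))"
    using pos[of "x 0"] by (intro continuous_intros) auto
  then show ?case
    by (rule continuous_on_eq) (simp add: hold_prob_0)
next
  case (Suc n)
  let ?f = "\<lambda>r. exp (r / s (x 0)) / s (x 0) * hold_prob s (\<lambda>k. x (Suc k)) n r"
  have s0: "s (x 0) \<noteq> 0" using pos[of "x 0"] by simp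
  show ?case
  proof (rule continuous_on_atLeast)
    fix b
    have "continuous_on {0..b} ?f"
      using s0 by (intro continuous_intros continuous_on_subset[OF Suc]) auto
    then have "continuous_on {0..b} (\<lambda>t. integral {0..t} ?f)"
      by (intro indefinite_integral_continuous_1 integrable_continuous_real)
    then have "continuous_on {0..b} (\<lambda>t. exp (- t / s (x 0)) * integral {0..t} ?f)"
      using s0 by (intro continuous_intros) auto
    then show "continuous_on {0..b} (hold_prob s x (Suc n))"
    proof (rule continuous_on_eq)
      fix t assume "t \<in> {0..b}"
      then have "integral {0..t} ?f = exp (t / s (x 0)) * hold_prob s x (Suc n) t"
        using hold_prob_Suc[OF _ Suc] by simp
      then show "exp (- t / s (x 0)) * integral {0..t} ?f = hold_prob s x (Suc n) t"
        by (simp add: exp_minus field_simps)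
    qed
  qed
qed

lemma continuous_on_jump_part:
  shows "continuous_on {0..} (\<lambda>t. jump_part s Y n t x)"
  unfolding jump_part_def
proof (rule continuous_on_sum)
  fix ds
  show "continuous_on {0..} (\<lambda>t. if x + sum_list ds \<in> Y then (1/2) ^ n * hold_prob s (\<lambda>k. x + path_pos ds k) n t else 0)"
    by (cases "x + sum_list ds \<in> Y") (auto intro!: continuous_intros continuous_on_hold_prob)
qed

lemma jump_part_0:
  assumes "0 \<le> t"
  shows "jump_part s Y 0 t x = indicator Y x * exp (- t / s x)"
  unfolding jump_part_def nn_steps_0 using hold_prob_0[OF assms] by (simp add: path_pos_def)

text \<open>First-step decomposition: the first jump goes to either neighbour with probability 1/2,
  after which \<open>n\<close> jumps remain. The holding-time recursion is applied path by path and
  the finite sum is exchanged with the integral.\<close>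

lemma jump_part_Suc:
  assumes "0 \<le> t"
  shows "exp (t / s x) * jump_part s Y (Suc n) t x =
    integral {0..t} (\<lambda>r. exp (r / s x) / s x * ((jump_part s Y n r (x + 1) + jump_part s Y n r (x - 1)) / 2))"
proof -
  have s0: "s x \<noteq> 0" using pos[of x] by simp
  have int: "(\<lambda>r. exp (r / s x) / s x * jump_part s Y n r y) integrable_on {0..t}" for y
    using s0 by (intro integrable_continuous_real continuous_intros continuous_on_subset[OF continuous_on_jump_part]) auto
  have step: "exp (t / s x) * (\<Sum>ds\<in>nn_steps n. if x + sum_list (d # ds) \<in> Y
       then (1/2) ^ Suc n * hold_prob s (\<lambda>k. x + path_pos (d # ds) k) (Suc n) t else 0)
     = integral {0..t} (\<lambda>r. exp (r / s x) / s x * jump_part s Y n r (x + d)) / 2" for d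
  proof -
    let ?c = "\<lambda>ds. if x + d + sum_list ds \<in> Y then (1/2) ^ n else (0::real)"
    let ?H = "\<lambda>ds. hold_prob s (\<lambda>k. x + d + path_pos ds k) n"
    have I: "(\<lambda>r. exp (r / s x) / s x * ?H ds r) integrable_on {0..t}" for ds
      using s0 by (intro integrable_continuous_real continuous_intros continuous_on_subset[OF continuous_on_hold_prob]) auto
    have H: "exp (t / s x) * hold_prob s (\<lambda>k. x + path_pos (d # ds) k) (Suc n) t
        = integral {0..t} (\<lambda>r. exp (r / s x) / s x * ?H ds r)" for ds
      using hold_prob_Suc[OF \<open>0 \<le> t\<close> continuous_on_hold_prob, where x = "\<lambda>k. x + path_pos (d # ds) k" and n = n]
      by (simp add: path_pos_def add.assoc)
    have "exp (t / s x) * (\<Sum>ds\<in>nn_steps n. if x + sum_list (d # ds) \<in> Y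
       then (1/2) ^ Suc n * hold_prob s (\<lambda>k. x + path_pos (d # ds) k) (Suc n) t else 0)
       = (\<Sum>ds\<in>nn_steps n. ?c ds / 2 * (exp (t / s x) * hold_prob s (\<lambda>k. x + path_pos (d # ds) k) (Suc n) t))"
      unfolding sum_distrib_left by (rule sum.cong) (auto simp: add.assoc)
    also have "\<dots> = (\<Sum>ds\<in>nn_steps n. integral {0..t} (\<lambda>r. ?c ds * (exp (r / s x) / s x * ?H ds r))) / 2"
      unfolding H sum_divide_distrib by (rule sum.cong) auto
    also have "\<dots> = integral {0..t} (\<lambda>r. \<Sum>ds\<in>nn_steps n. ?c ds * (exp (r / s x) / s x * ?H ds r)) / 2"
      by (subst integral_sum[OF finite_nn_steps]) (use integrable_on_mult_right[OF I] in auto)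
    also have "(\<lambda>r. \<Sum>ds\<in>nn_steps n. ?c ds * (exp (r / s x) / s x * ?H ds r)) = (\<lambda>r. exp (r / s x) / s x * jump_part s Y n r (x + d))"
      unfolding jump_part_def sum_distrib_left by (intro ext sum.cong) auto
    finally show ?thesis .
  qed
  have "jump_part s Y (Suc n) t x
    = (\<Sum>ds\<in>nn_steps n. if x + sum_list (1 # ds) \<in> Y
         then (1/2) ^ Suc n * hold_prob s (\<lambda>k. x + path_pos (1 # ds) k) (Suc n) t else 0)
    + (\<Sum>ds\<in>nn_steps n. if x + sum_list (-1 # ds) \<in> Y
         then (1/2) ^ Suc n * hold_prob s (\<lambda>k. x + path_pos (-1 # ds) k) (Suc n) t else 0)"
    unfolding jump_part_def nn_steps_Suc
    by (subst sum.union_disjoint) (auto simp: finite_nn_steps sum.reindex inj_on_def simp del: sum_list.Cons)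
  then have "exp (t / s x) * jump_part s Y (Suc n) t x
     = integral {0..t} (\<lambda>r. exp (r / s x) / s x * jump_part s Y n r (x + 1)) / 2
     + integral {0..t} (\<lambda>r. exp (r / s x) / s x * jump_part s Y n r (x + -1)) / 2"
    by (simp only: distrib_left step)
  also have "\<dots> = integral {0..t} (\<lambda>r. exp (r / s x) / s x * jump_part s Y n r (x + 1)
      + exp (r / s x) / s x * jump_part s Y n r (x - 1)) / 2"
    by (subst integral_add[OF int int]) (simp add: add_divide_distrib)
  also have "\<dots> = integral {0..t} (\<lambda>r. (exp (r / s x) / s x * jump_part s Y n r (x + 1)
      + exp (r / s x) / s x * jump_part s Y n r (x - 1)) / 2)"
    by (simp only: integral_divide)
  also have "\<dots> = integral {0..t} (\<lambda>r. exp (r / s x) / s x * ((jump_part s Y n r (x + 1) + jump_part s Y n r (x - 1)) / 2))"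
    by (simp only: distrib_left[symmetric] times_divide_eq_right)
  finally show ?thesis .
qed

end

section \<open>Transition probabilities and their evolution in time\<close>

definition walk_prob :: "(int \<Rightarrow> real) \<Rightarrow> int set \<Rightarrow> real \<Rightarrow> int \<Rightarrow> real" where
  "walk_prob s Y t x = (\<Sum>n. jump_part s Y n t x)"

lemma BTM_prob_eq_walk_prob: "BTM_prob s t y = walk_prob s {y} t 0"
  by (simp only: BTM_prob_def walk_prob_def jump_part_def add_0 singleton_iff)

lemma integral_exp_div:
  fixes c t :: real
  assumes "0 < c" "0 \<le> t"
  shows "((\<lambda>r. exp (r / c) / c) has_integral (exp (t / c) - 1)) {0..t}"
proof -
  have "((\<lambda>r. exp (r / c) / c) has_integral (exp (t / c) - exp (0 / c))) {0..t}"
    using assms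
    by (intro fundamental_theorem_of_calculus)
       (auto intro!: derivative_eq_intros simp flip: has_real_derivative_iff_has_vector_derivative)
  then show ?thesis by simp
qed

context landscape
begin

lemma continuous_on_sum_jump_part:
  shows "continuous_on {0..t} (\<lambda>r. \<Sum>n<N. jump_part s Y n r x)"
  by (intro continuous_on_sum continuous_on_subset[OF continuous_on_jump_part]) auto

lemma integrable_sum_jump_part:
  shows "(\<lambda>r. exp (r / s x) / s x *
      (((\<Sum>n<N. jump_part s Y n r (x + 1)) + (\<Sum>n<N. jump_part s Y n r (x - 1))) / 2)) integrable_on {0..t}"
  using pos[of x] by (intro integrable_continuous_real continuous_intros continuous_on_sum_jump_part) auto

text \<open>Backward equation in integrated form for paths with at most \<open>N\<close> jumps. The
  jump count drops by one on the right, which permits induction on \<open>N\<close>.\<close>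

lemma sum_jump_part_Suc:
  assumes "0 \<le> t"
  shows "exp (t / s x) * (\<Sum>n<Suc N. jump_part s Y n t x) = indicator Y x +
    integral {0..t} (\<lambda>r. exp (r / s x) / s x *
      (((\<Sum>n<N. jump_part s Y n r (x + 1)) + (\<Sum>n<N. jump_part s Y n r (x - 1))) / 2))"
proof (induction N)
  case 0
  then show ?case
    by (simp add: jump_part_0[OF assms] exp_minus)
next
  case (Suc N)
  let ?f = "\<lambda>r. exp (r / s x) / s x * ((jump_part s Y N r (x + 1) + jump_part s Y N r (x - 1)) / 2)"
  let ?g = "\<lambda>r. exp (r / s x) / s x *
      (((\<Sum>n<N. jump_part s Y n r (x + 1)) + (\<Sum>n<N. jump_part s Y n r (x - 1))) / 2)"
  have "?f integrable_on {0..t}"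
    using pos[of x]
    by (intro integrable_continuous_real continuous_intros continuous_on_subset[OF continuous_on_jump_part]) auto
  then have "integral {0..t} (\<lambda>r. ?g r + ?f r) = integral {0..t} ?g + integral {0..t} ?f"
    by (intro integral_add integrable_sum_jump_part)
  moreover have "(\<lambda>r. ?g r + ?f r) = (\<lambda>r. exp (r / s x) / s x *
      (((\<Sum>n<Suc N. jump_part s Y n r (x + 1)) + (\<Sum>n<Suc N. jump_part s Y n r (x - 1))) / 2))"
    by (simp only: sum.lessThan_Suc distrib_left add_divide_distrib add_ac)
  ultimately have "integral {0..t} (\<lambda>r. exp (r / s x) / s x *
      (((\<Sum>n<Suc N. jump_part s Y n r (x + 1)) + (\<Sum>n<Suc N. jump_part s Y n r (x - 1))) / 2))
    = integral {0..t} ?g + integral {0..t} ?f"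
    by (simp only:)
  then show ?case
    unfolding sum.lessThan_Suc[of _ "Suc N"] distrib_left Suc jump_part_Suc[OF assms]
    by (simp only: add.assoc)
qed

text \<open>If the neighbouring values are at most 1, the right-hand side of the recursion is at
  most \<open>indicator Y x + (exp (t / s x) - 1)\<close>, hence at most
  \<open>exp (t / s x)\<close>. This gives total mass at most 1 by induction, without a joint
  probability space for all paths.\<close>

lemma sum_jump_part_le_1:
  assumes "0 \<le> t"
  shows "(\<Sum>n<N. jump_part s Y n t x) \<le> 1"
  using assms
proof (induction N arbitrary: t x)
  case 0
  then show ?case by simp
next
  case (Suc N)
  have "integral {0..t} (\<lambda>r. exp (r / s x) / s x *
      (((\<Sum>n<N. jump_part s Y n r (x + 1)) + (\<Sum>n<N. jump_part s Y n r (x - 1))) / 2))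
     \<le> integral {0..t} (\<lambda>r. exp (r / s x) / s x)"
  proof (rule integral_le[OF integrable_sum_jump_part])
    show "(\<lambda>r. exp (r / s x) / s x) integrable_on {0..t}"
      using integral_exp_div[OF pos[of x] Suc.prems] by blast
    fix r assume "r \<in> {0..t}"
    then have "((\<Sum>n<N. jump_part s Y n r (x + 1)) + (\<Sum>n<N. jump_part s Y n r (x - 1))) / 2 \<le> 1"
      using Suc.IH[of r "x+1"] Suc.IH[of r "x-1"] by simp
    then show "exp (r / s x) / s x * (((\<Sum>n<N. jump_part s Y n r (x + 1)) + (\<Sum>n<N. jump_part s Y n r (x - 1))) / 2)
        \<le> exp (r / s x) / s x"
      using pos[of x] by (intro mult_left_le) auto
  qed
  also have "\<dots> = exp (t / s x) - 1"
    using integral_exp_div[OF pos[of x] Suc.prems] by (rule integral_unique)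
  finally have "exp (t / s x) * (\<Sum>n<Suc N. jump_part s Y n t x) \<le> indicator Y x + (exp (t / s x) - 1)"
    by (subst sum_jump_part_Suc[OF Suc.prems]) simp
  also have "\<dots> \<le> exp (t / s x) * 1"
    by (simp add: indicator_def)
  finally have "exp (t / s x) * (\<Sum>n<Suc N. jump_part s Y n t x) \<le> exp (t / s x) * 1" .
  then show ?case
    by (subst (asm) mult_le_cancel_left_pos) simp_all
qed

lemma summable_jump_part:
  assumes "0 \<le> t"
  shows "summable (\<lambda>n. jump_part s Y n t x)"
  by (rule summableI_nonneg_bounded[where x = 1]) (auto simp: jump_part_nonneg sum_jump_part_le_1[OF assms])

lemma walk_prob_nonneg:
  assumes "0 \<le> t"
  shows "0 \<le> walk_prob s Y t x"
  unfolding walk_prob_def by (intro suminf_nonneg summable_jump_part[OF assms] jump_part_nonneg)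

lemma walk_prob_le_1:
  assumes "0 \<le> t"
  shows "walk_prob s Y t x \<le> 1"
  unfolding walk_prob_def by (intro suminf_le_const summable_jump_part[OF assms] sum_jump_part_le_1[OF assms])

lemma walk_prob_insert:
  assumes "0 \<le> t" and "y \<noteq> z"
  shows "walk_prob s {y, z} t x = walk_prob s {y} t x + walk_prob s {z} t x"
proof -
  have "jump_part s {y, z} n t x = jump_part s {y} n t x + jump_part s {z} n t x" for n
    unfolding jump_part_def sum.distrib[symmetric] using \<open>y \<noteq> z\<close> by (intro sum.cong) auto
  then show ?thesis
    unfolding walk_prob_def by (simp add: suminf_add summable_jump_part[OF assms(1)])
qed

text \<open>Passage to infinitely many jumps by dominated convergence. The partial sums are at most
  1, so \<open>exp (r / s x) / s x\<close> dominates.\<close>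

lemma walk_prob_integral:
  fixes Y :: "int set"
  assumes t: "0 \<le> t"
  defines "f \<equiv> \<lambda>x r. exp (r / s x) / s x * ((walk_prob s Y r (x + 1) + walk_prob s Y r (x - 1)) / 2)"
  shows "f x integrable_on {0..t}"
    and "exp (t / s x) * walk_prob s Y t x = indicator Y x + integral {0..t} (f x)"
proof -
  let ?F = "\<lambda>N r. exp (r / s x) / s x *
      (((\<Sum>n<N. jump_part s Y n r (x + 1)) + (\<Sum>n<N. jump_part s Y n r (x - 1))) / 2)"
  let ?h = "\<lambda>r. exp (r / s x) / s x"
  have h: "?h integrable_on {0..t}"
    using integral_exp_div[OF pos[of x] t] by blast
  have bound: "norm (?F N r) \<le> ?h r" if "r \<in> {0..t}" for N r
  proof -
    have le_1: "(\<Sum>n<N. jump_part s Y n r y) \<le> 1" for y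
      using that by (intro sum_jump_part_le_1) auto
    have "((\<Sum>n<N. jump_part s Y n r (x + 1)) + (\<Sum>n<N. jump_part s Y n r (x - 1))) / 2 \<le> 1"
      using le_1[of "x + 1"] le_1[of "x - 1"] by simp
    moreover have nn: "0 \<le> ((\<Sum>n<N. jump_part s Y n r (x + 1)) + (\<Sum>n<N. jump_part s Y n r (x - 1))) / 2"
      by (intro divide_nonneg_nonneg add_nonneg_nonneg sum_nonneg jump_part_nonneg) simp
    ultimately show ?thesis
      unfolding real_norm_def abs_mult abs_of_nonneg[OF nn] using pos[of x] by (simp add: mult_left_le del: times_divide_eq_right times_divide_eq_left times_divide_times_eq)
  qed
  have ptw: "(\<lambda>N. ?F N r) \<longlonglongrightarrow> f x r" if "r \<in> {0..t}" for r
  proof -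
    have "(\<lambda>N. \<Sum>n<N. jump_part s Y n r y) \<longlonglongrightarrow> walk_prob s Y r y" for y
      unfolding walk_prob_def using that by (intro summable_LIMSEQ summable_jump_part) auto
    then show ?thesis
      unfolding f_def using pos[of x] by (intro tendsto_intros) auto
  qed
  show "f x integrable_on {0..t}"
    by (rule dominated_convergence(1)[OF integrable_sum_jump_part h bound ptw])
  have lim: "(\<lambda>N. integral {0..t} (?F N)) \<longlonglongrightarrow> integral {0..t} (f x)"
    by (rule dominated_convergence(2)[OF integrable_sum_jump_part h bound ptw])
  have "(\<lambda>N. \<Sum>n<Suc N. jump_part s Y n t x) \<longlonglongrightarrow> walk_prob s Y t x"
    unfolding walk_prob_def by (intro LIMSEQ_Suc summable_LIMSEQ summable_jump_part t)
  then have "(\<lambda>N. exp (t / s x) * (\<Sum>n<Suc N. jump_part s Y n t x)) \<longlonglongrightarrow> exp (t / s x) * walk_prob s Y t x"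
    by (intro tendsto_intros)
  moreover have "(\<lambda>N. exp (t / s x) * (\<Sum>n<Suc N. jump_part s Y n t x)) \<longlonglongrightarrow> indicator Y x + integral {0..t} (f x)"
    unfolding sum_jump_part_Suc[OF t] by (intro tendsto_intros lim)
  ultimately show "exp (t / s x) * walk_prob s Y t x = indicator Y x + integral {0..t} (f x)"
    by (rule LIMSEQ_unique)
qed

lemma walk_prob_0:
  shows "walk_prob s Y 0 x = indicator Y x"
  using walk_prob_integral(2)[where t=0 and x=x and Y=Y] by simp

lemma continuous_on_walk_prob:
  shows "continuous_on {0..b} (\<lambda>t. walk_prob s Y t x)"
proof -
  let ?f = "\<lambda>r. exp (r / s x) / s x * ((walk_prob s Y r (x + 1) + walk_prob s Y r (x - 1)) / 2)"
  show ?thesis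
  proof (cases "0 \<le> b")
    case True
    have "continuous_on {0..b} (\<lambda>t. exp (- t / s x) * (indicator Y x + integral {0..t} ?f))"
      using pos[of x]
      by (intro continuous_intros indefinite_integral_continuous_1 walk_prob_integral(1)[OF True]) auto
    then show ?thesis
    proof (rule continuous_on_eq)
      fix t assume "t \<in> {0..b}"
      then show "exp (- t / s x) * (indicator Y x + integral {0..t} ?f) = walk_prob s Y t x"
        using walk_prob_integral(2)[where t=t and x=x and Y=Y] by (simp add: exp_minus field_simps)
    qed
  qed simp
qed

text \<open>Kolmogorov's backward equation in differential form: the product rule is applied to
  \<open>exp (- t / s x)\<close> times the integrated equation, whose integrand is continuous by
  now. The derivative is one-sided at the ends of the interval.\<close>

lemma walk_prob_has_derivative:
  assumes t: "t \<in> {0..b}"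
  shows "((\<lambda>t. walk_prob s Y t x) has_real_derivative
     (walk_prob s Y t (x + 1) - 2 * walk_prob s Y t x + walk_prob s Y t (x - 1)) / (2 * s x)) (at t within {0..b})"
proof -
  let ?f = "\<lambda>r. exp (r / s x) / s x * ((walk_prob s Y r (x + 1) + walk_prob s Y r (x - 1)) / 2)"
  let ?I = "indicator Y x + integral {0..t} ?f"
  have sx: "s x \<noteq> 0" using pos[of x] by simp
  have "continuous_on {0..b} ?f"
    using sx by (intro continuous_intros continuous_on_walk_prob) auto
  then have I: "((\<lambda>t. integral {0..t} ?f) has_real_derivative ?f t) (at t within {0..b})"
    unfolding has_real_derivative_iff_has_vector_derivative
    using t by (rule integral_has_vector_derivative)
  have u: "?I = exp (t / s x) * walk_prob s Y t x"
    using walk_prob_integral(2)[where t=t and x=x and Y=Y] t by simp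
  have e: "exp (- t / s x) * exp (t / s x) = 1"
    by (simp add: exp_add[symmetric])
  have "((\<lambda>t. exp (- t / s x) * (indicator Y x + integral {0..t} ?f)) has_real_derivative
       exp (- t / s x) * ?f t - exp (- t / s x) / s x * ?I) (at t within {0..b})"
  proof (rule DERIV_cong[OF DERIV_mult[OF _ DERIV_add[OF DERIV_const I]]])
    show "((\<lambda>t. exp (- t / s x)) has_real_derivative - (exp (- t / s x) / s x)) (at t within {0..b})"
      using sx by (auto intro!: derivative_eq_intros)
  qed (simp only: add_0 minus_mult_left[symmetric] mult.commute[of "?f t"] uminus_add_conv_diff)
  also have "exp (- t / s x) * ?f t - exp (- t / s x) / s x * ?I
     = (exp (- t / s x) * exp (t / s x)) * ((walk_prob s Y t (x + 1) + walk_prob s Y t (x - 1)) / (2 * s x) - walk_prob s Y t x / s x)"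
    unfolding u by (simp add: field_simps)
  also have "\<dots> = (walk_prob s Y t (x + 1) - 2 * walk_prob s Y t x + walk_prob s Y t (x - 1)) / (2 * s x)"
    unfolding e using sx by (simp add: field_simps)
  finally show ?thesis
  proof (rule has_field_derivative_transform_within[OF _ zero_less_one t])
    fix r assume "r \<in> {0..b}"
    then show "exp (- r / s x) * (indicator Y x + integral {0..r} ?f) = walk_prob s Y r x"
      using walk_prob_integral(2)[where t=r and x=x and Y=Y] by (simp add: exp_minus field_simps)
  qed
qed

end

subsection \<open>Staying in a trap and reaching the traps\<close>

text \<open>Left unnormalised: the generator of the trap model is
  \<open>laplacian f x / (2 * s x)\<close>.\<close>

definition laplacian :: "(int \<Rightarrow> real) \<Rightarrow> int \<Rightarrow> real" where
  "laplacian f x = f (x + 1) - 2 * f x + f (x - 1)"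

lemma atLeastAtMost_int_widen:
  fixes z :: int
  shows "{z - int (Suc a)..z + int (Suc a)} = insert (z - int (Suc a)) (insert (z + int (Suc a)) {z - int a..z + int a})"
  by auto

lemma sum_widen:
  fixes f :: "int \<Rightarrow> real"
  shows "(\<Sum>x\<in>{z - int (Suc a)..z + int (Suc a)}. f x)
    = f (z - int (Suc a)) + f (z + int (Suc a)) + (\<Sum>x\<in>{z - int a..z + int a}. f x)"
  unfolding atLeastAtMost_int_widen by simp

lemma sum_laplacian:
  "(\<Sum>x\<in>{z - int a..z + int a}. laplacian f x)
     = f (z + int a + 1) - f (z + int a) + f (z - int a - 1) - f (z - int a)"
proof (induction a)
  case 0
  then show ?case by (simp add: laplacian_def)
next
  case (Suc a)
  show ?case unfolding sum_widen Suc by (simp add: laplacian_def algebra_simps)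
qed

text \<open>Summation by parts: the tent is affine apart from its peak and the two ends, so only
  three values survive. Raising the tent by one adds the plain sum of Laplacians, which telescopes,
  and the weights at the two new end points are zero.\<close>

lemma sum_tent_laplacian:
  "(\<Sum>x\<in>{z - int a..z + int a}. (real a - \<bar>real_of_int (x - z)\<bar>) * laplacian f x)
     = f (z + int a) + f (z - int a) - 2 * f z"
proof (induction a)
  case 0
  then show ?case by simp
next
  case (Suc a)
  have eq: "(\<Sum>x\<in>{z - int a..z + int a}. (real (Suc a) - \<bar>real_of_int (x - z)\<bar>) * laplacian f x)
     = (\<Sum>x\<in>{z - int a..z + int a}. (real a - \<bar>real_of_int (x - z)\<bar>) * laplacian f x)
      + (\<Sum>x\<in>{z - int a..z + int a}. laplacian f x)"
    by (simp add: sum.distrib[symmetric] algebra_simps)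
  have ends: "real (Suc a) - \<bar>real_of_int (z - int (Suc a) - z)\<bar> = 0"
    "real (Suc a) - \<bar>real_of_int (z + int (Suc a) - z)\<bar> = 0" by simp_all
  show ?case
    unfolding sum_widen ends eq Suc sum_laplacian by (simp add: algebra_simps)
qed

section \<open>Lower bounds for the transition probabilities\<close>

context landscape
begin

text \<open>The chain is reversible with respect to \<open>s\<close>, so weighting by
  \<open>s\<close> cancels the factor \<open>1 / s x\<close> of the generator. \<open>Q\<close>
  starts at \<open>a * s z\<close> and hardly decreases, while the sites other than \<open>z\<close>
  can carry at most \<open>a\<close> times their total depth; the rest of \<open>Q t\<close> must
  sit at \<open>z\<close>.\<close>

lemma walk_prob_trap_lower_bound:
  fixes a :: nat
  assumes "0 < a" "0 \<le> t"
  shows "1 - t / (a * s z) - (\<Sum>x\<in>{z - int a..z + int a} - {z}. s x) / s z \<le> walk_prob s {z} t z"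
proof -
  let ?J = "{z - int a..z + int a}" and ?u = "walk_prob s {z}"
  let ?w = "\<lambda>x. real a - \<bar>real_of_int (x - z)\<bar>"
  \<comment> \<open>By summation by parts the tent weights \<open>?w\<close> turn the derivative of \<open>Q\<close> into values of \<open>?u\<close> at
    three sites only, so that \<open>Q\<close> loses at most \<open>t\<close> up to time \<open>t\<close>.\<close>
  define Q where "Q r = (\<Sum>x\<in>?J. s x * ?w x * ?u r x)" for r
  have dQ: "(Q has_real_derivative (?u r (z + int a) + ?u r (z - int a) - 2 * ?u r z) / 2) (at r within {0..t})"
    if "r \<in> {0..t}" for r
  proof -
    have "(Q has_real_derivative (\<Sum>x\<in>?J. s x * ?w x * (laplacian (?u r) x / (2 * s x)))) (at r within {0..t})"
      unfolding Q_def laplacian_def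
      by (intro DERIV_sum DERIV_cmult walk_prob_has_derivative that)
    also have "(\<Sum>x\<in>?J. s x * ?w x * (laplacian (?u r) x / (2 * s x))) = (\<Sum>x\<in>?J. ?w x * laplacian (?u r) x) / 2"
      unfolding sum_divide_distrib
    proof (rule sum.cong)
      fix x
      show "s x * ?w x * (laplacian (?u r) x / (2 * s x)) = ?w x * laplacian (?u r) x / 2"
        using pos[of x] by (simp add: field_simps)
    qed simp
    finally show ?thesis unfolding sum_tent_laplacian .
  qed
  \<comment> \<open>One intermediate point is enough: the three values of \<open>?u\<close> there
    lie between 0 and 1, so the derivative of \<open>Q\<close> is at least -1.\<close>
  have "\<exists>r\<in>{0..t}. Q t - Q 0 = (?u r (z + int a) + ?u r (z - int a) - 2 * ?u r z) / 2 * (t - 0)"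
    by (rule mvt_very_simple[OF assms(2)]) (rule dQ[unfolded has_field_derivative_def], simp)
  then obtain r where r: "r \<in> {0..t}" and
    Q: "Q t - Q 0 = (?u r (z + int a) + ?u r (z - int a) - 2 * ?u r z) / 2 * t" by auto
  have "0 \<le> ?u r x" "?u r x \<le> 1" for x
    using r walk_prob_nonneg walk_prob_le_1 by auto
  from this(1)[of "z + int a"] this(1)[of "z - int a"] this(2)[of z]
  have "-1 \<le> (?u r (z + int a) + ?u r (z - int a) - 2 * ?u r z) / 2" by simp
  from mult_right_mono[OF this assms(2)] have "- t \<le> Q t - Q 0"
    unfolding Q by simp
  moreover have "Q 0 = a * s z"
  proof -
    have "Q 0 = (\<Sum>x\<in>?J. if x = z then a * s z else 0)"
      unfolding Q_def by (rule sum.cong) (auto simp: walk_prob_0)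
    then show ?thesis by simp
  qed
  moreover have "Q t \<le> a * (s z * ?u t z + (\<Sum>x\<in>?J - {z}. s x))"
  proof -
    have "Q t = s z * a * ?u t z + (\<Sum>x\<in>?J - {z}. s x * ?w x * ?u t x)"
      unfolding Q_def by (subst sum.remove[of _ z]) auto
    also have "(\<Sum>x\<in>?J - {z}. s x * ?w x * ?u t x) \<le> (\<Sum>x\<in>?J - {z}. s x * a)"
    proof (rule sum_mono)
      fix x assume "x \<in> ?J - {z}"
      then have w: "0 \<le> ?w x" "?w x \<le> a" by auto
      have "?w x * ?u t x \<le> real a * 1"
        by (intro mult_mono w walk_prob_nonneg walk_prob_le_1 assms(2)) auto
      then show "s x * ?w x * ?u t x \<le> s x * a"
        using pos[of x] by (simp add: mult.assoc)
    qed
    finally show ?thesis by (simp add: sum_distrib_left algebra_simps)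
  qed
  ultimately have "a * s z \<le> t + a * (s z * ?u t z + (\<Sum>x\<in>?J - {z}. s x))" by simp
  moreover have "a * s z * (1 - t / (a * s z) - (\<Sum>x\<in>?J - {z}. s x) / s z)
      = a * s z - t - a * (\<Sum>x\<in>?J - {z}. s x)"
    using assms(1) pos[of z] by (simp add: right_diff_distrib)
  ultimately have "a * s z * (1 - t / (a * s z) - (\<Sum>x\<in>?J - {z}. s x) / s z) \<le> a * s z * ?u t z"
    by (simp only: distrib_left mult.assoc)
  then show ?thesis
    using assms(1) pos[of z] by (subst (asm) mult_le_cancel_left_pos) auto
qed

text \<open>Parabolic minimum principle for supersolutions. After adding a small strictly increasing
  term, consider the first time at which a nonpositive value occurs inside. It is a spatial minimum
  with value 0, so the Laplacian is nonnegative and the time derivative strictly positive; hence the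
  value was negative slightly earlier, a contradiction.\<close>

lemma discrete_minimum_principle:
  fixes D D' :: "real \<Rightarrow> int \<Rightarrow> real"
  assumes der: "\<And>r x. r \<in> {0..t} \<Longrightarrow> x \<in> {A<..<B} \<Longrightarrow> ((\<lambda>r. D r x) has_real_derivative D' r x) (at r within {0..t})"
    and super: "\<And>r x. r \<in> {0..t} \<Longrightarrow> x \<in> {A<..<B} \<Longrightarrow> laplacian (D r) x / (2 * s x) \<le> D' r x"
    and bd: "\<And>r. r \<in> {0..t} \<Longrightarrow> 0 \<le> D r A" "\<And>r. r \<in> {0..t} \<Longrightarrow> 0 \<le> D r B"
    and init: "\<And>x. x \<in> {A<..<B} \<Longrightarrow> 0 \<le> D 0 x"
    and rx: "r \<in> {0..t}" "x \<in> {A..B}"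
  shows "0 \<le> D r x"
proof (rule ccontr)
  assume neg: "\<not> 0 \<le> D r x"
  with bd rx have x: "x \<in> {A<..<B}" by (cases "x = A"; cases "x = B") auto
  \<comment> \<open>Chosen so that the perturbed function \<open>E\<close> below is still
    nonpositive at the offending point:
    \<open>\<epsilon> * (1 + r) \<le> \<epsilon> * (1 + t) = - D r x\<close>.\<close>
  define \<epsilon> where "\<epsilon> = - D r x / (1 + t)"
  have t: "0 \<le> t" using rx by auto
  have \<epsilon>: "0 < \<epsilon>" unfolding \<epsilon>_def using neg t by (intro divide_pos_pos) auto
  define E where "E q y = D q y + \<epsilon> * (1 + q)" for q y
  have derE: "((\<lambda>q. E q y) has_real_derivative D' q y + \<epsilon>) (at q within {0..t})"
    if "q \<in> {0..t}" "y \<in> {A<..<B}" for q y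
    unfolding E_def using der[OF that] by (auto intro!: derivative_eq_intros)
  have contE: "continuous_on {0..t} (\<lambda>q. E q y)" if "y \<in> {A<..<B}" for y
    by (rule DERIV_continuous_on) (rule derE[OF _ that])
  have "E r x \<le> 0"
  proof -
    have "\<epsilon> * (1 + r) \<le> \<epsilon> * (1 + t)" using \<epsilon> rx by simp
    also have "\<dots> = - D r x" using t by (simp add: \<epsilon>_def)
    finally show ?thesis by (simp add: E_def)
  qed
  \<comment> \<open>The times at which \<open>E\<close> is nonpositive at some interior site: a
    finite union of compact sets, so a first such time exists.\<close>
  define Bad where "Bad = (\<Union>y\<in>{A<..<B}. {0..t} \<inter> (\<lambda>q. E q y) -` {..0})"
  have "r \<in> Bad" using \<open>E r x \<le> 0\<close> x rx by (auto simp: Bad_def)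
  moreover have "compact Bad"
    unfolding Bad_def
  proof (rule compact_UN)
    fix y assume "y \<in> {A<..<B}"
    then have "closed ({0..t} \<inter> (\<lambda>q. E q y) -` {..0})"
      by (intro continuous_closed_preimage contE) auto
    from compact_Int_closed[OF compact_Icc this, of 0 t]
    show "compact ({0..t} \<inter> (\<lambda>q. E q y) -` {..0})"
      by (simp only: Int_assoc[symmetric] Int_absorb)
  qed simp
  ultimately obtain q where q: "q \<in> Bad" and min: "\<And>p. p \<in> Bad \<Longrightarrow> q \<le> p"
    using compact_attains_inf[of Bad] by auto
  from q obtain y where y: "y \<in> {A<..<B}" and q0: "q \<in> {0..t}" and Eq: "E q y \<le> 0"
    by (auto simp: Bad_def)
  have E0: "0 < E 0 w" if "w \<in> {A<..<B}" for w
    using init[OF that] \<epsilon> by (simp add: E_def)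
  have nonneg: "0 \<le> E q w" if w: "w \<in> {A..B}" for w
  proof (cases "w \<in> {A<..<B}")
    case True
    show ?thesis
    proof (rule ccontr)
      assume "\<not> 0 \<le> E q w"
      moreover have "continuous_on {0..q} (\<lambda>q. E q w)"
        using q0 by (intro continuous_on_subset[OF contE[OF True]]) auto
      \<comment> \<open>A negative value at time \<open>q\<close> would force a zero before
        \<open>q\<close>, against the minimality of \<open>q\<close>.\<close>
      ultimately obtain p where p: "0 \<le> p" "p \<le> q" "E p w = 0"
        using IVT2'[of "\<lambda>q. E q w" q 0 0] E0[OF True] q0 by auto
      then have "p \<in> Bad" using True q0 by (auto simp: Bad_def intro!: bexI[of _ w])
      from min[OF this] p have "p = q" by simp
      with p \<open>\<not> 0 \<le> E q w\<close> show False by simp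
    qed
  next
    case False
    with w have "w = A \<or> w = B" by auto
    then show ?thesis using bd[OF q0] \<epsilon> q0 by (auto simp: E_def)
  qed
  have "E q y = 0" using Eq nonneg[of y] y by auto
  have "q \<noteq> 0" using E0[OF y] Eq by auto
  then have "0 < q" using q0 by auto
  have "0 \<le> laplacian (E q) y"
    using nonneg[of "y+1"] nonneg[of "y-1"] y \<open>E q y = 0\<close> by (auto simp: laplacian_def)
  also have "laplacian (E q) y = laplacian (D q) y"
    by (simp add: laplacian_def E_def)
  finally have "0 \<le> laplacian (D q) y / (2 * s y)"
    using pos[of y] by simp
  with super[OF q0 y] \<epsilon> have "0 < D' q y + \<epsilon>" by simp
  from has_real_derivative_pos_inc_left[OF derE[OF q0 y] this]
  obtain d where d: "0 < d" "\<And>h. 0 < h \<Longrightarrow> q - h \<in> {0..t} \<Longrightarrow> h < d \<Longrightarrow> E (q - h) y < E q y"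
    by blast
  \<comment> \<open>Small enough for the strict decrease to apply, and at most \<open>q\<close> so
    that the earlier time is not negative.\<close>
  define h where "h = min (d / 2) q"
  have h: "0 < h" "h < d" "q - h \<in> {0..t}"
    using d \<open>0 < q\<close> q0 by (auto simp: h_def min_def)
  then have "E (q - h) y < 0" using d(2) \<open>E q y = 0\<close> by auto
  then have "q - h \<in> Bad" using h y by (auto simp: Bad_def intro!: bexI[of _ y])
  from min[OF this] h show False by simp
qed

text \<open>Comparison with \<open>c * (h x - exp (- r / (2 * W)) * \<phi> x)\<close>. This is a
  subsolution because \<open>h\<close> is harmonic and \<open>\<phi> \<le> 2\<close> keeps the decay
  rate \<open>1 / (2 * W)\<close> below what the generator of \<open>\<phi>\<close> allows; it is
  nonpositive at time 0 because \<open>h \<le> 1 \<le> \<phi>\<close>. The number \<open>W\<close>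
  bounds the mean exit time from the interval.\<close>

lemma walk_prob_exit_lower_bound:
  fixes h :: "int \<Rightarrow> real"
  assumes "0 \<le> t" and x: "x \<in> {A..B}" and "0 \<le> c" and "0 < W"
    and W: "real_of_int (B - A) * (\<Sum>z\<in>{A<..<B}. s z) \<le> W"
    and h_le: "\<And>x. x \<in> {A..B} \<Longrightarrow> h x \<le> 1"
    and harmonic: "\<And>x. x \<in> {A<..<B} \<Longrightarrow> laplacian h x = 0"
    and bdA: "\<And>r. r \<in> {0..t} \<Longrightarrow> c * h A \<le> walk_prob s Y r A"
    and bdB: "\<And>r. r \<in> {0..t} \<Longrightarrow> c * h B \<le> walk_prob s Y r B"
  shows "c * (h x - 2 * exp (- t / (2 * W))) \<le> walk_prob s Y t x"
proof -
  let ?I = "{A<..<B}"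
  \<comment> \<open>\<open>\<phi>\<close> is a barrier: its values lie in \<open>[1, 2]\<close> and its generator is \<open>- 1 / W\<close> inside, because
    \<open>\<bar>x - z\<bar> / 2\<close> is a Green function of the discrete Laplacian.\<close>
  define \<phi> where "\<phi> x = 2 - (\<Sum>z\<in>?I. s z * \<bar>real_of_int (x - z)\<bar>) / W" for x
  have \<phi>_le: "\<phi> x \<le> 2" for x
  proof -
    have "0 \<le> (\<Sum>z\<in>?I. s z * \<bar>real_of_int (x - z)\<bar>) / W"
      by (intro divide_nonneg_nonneg sum_nonneg mult_nonneg_nonneg less_imp_le[OF pos] less_imp_le[OF \<open>0 < W\<close>] abs_ge_zero)
    then show ?thesis by (simp add: \<phi>_def)
  qed
  have \<phi>_ge: "1 \<le> \<phi> x" if "x \<in> {A..B}" for x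
  proof -
    have "(\<Sum>z\<in>?I. s z * \<bar>real_of_int (x - z)\<bar>) \<le> (\<Sum>z\<in>?I. s z * real_of_int (B - A))"
      using that pos by (intro sum_mono mult_left_mono less_imp_le) auto
    also have "\<dots> \<le> W" using W by (simp add: sum_distrib_right[symmetric] mult.commute)
    finally show ?thesis using \<open>0 < W\<close> by (simp add: \<phi>_def field_simps)
  qed
  have lap_\<phi>: "laplacian \<phi> x = - (2 * s x / W)" if x: "x \<in> ?I" for x
  proof -
    have "laplacian \<phi> x = - (\<Sum>z\<in>?I. s z * laplacian (\<lambda>x. \<bar>real_of_int (x - z)\<bar>) x) / W"
      by (simp add: \<phi>_def laplacian_def sum.distrib sum_subtractf sum_distrib_left algebra_simps
          add_divide_distrib diff_divide_distrib)
    also have "(\<Sum>z\<in>?I. s z * laplacian (\<lambda>x. \<bar>real_of_int (x - z)\<bar>) x) = (\<Sum>z\<in>?I. if z = x then 2 * s x else 0)"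
      by (rule sum.cong) (auto simp: laplacian_def abs_if)
    finally show ?thesis using x by simp
  qed
  let ?e = "\<lambda>r. exp (- r / (2 * W))"
  define D where "D r x = walk_prob s Y r x - c * (h x - ?e r * \<phi> x)" for r x
  define D' where "D' r x = laplacian (walk_prob s Y r) x / (2 * s x) - c * (?e r * \<phi> x / (2 * W))" for r x
  have "0 \<le> D t x"
  proof (rule discrete_minimum_principle[where D = D and D' = D' and A = A and B = B and t = t])
    fix r x assume r: "r \<in> {0..t}" and x: "x \<in> ?I"
    show "((\<lambda>r. D r x) has_real_derivative D' r x) (at r within {0..t})"
      unfolding D_def D'_def laplacian_def using \<open>0 < W\<close>
      by (auto intro!: derivative_eq_intros walk_prob_has_derivative r)
    have "laplacian (D r) x = laplacian (walk_prob s Y r) x - c * (laplacian h x - ?e r * laplacian \<phi> x)"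
      by (simp add: D_def laplacian_def algebra_simps)
    also have "\<dots> = laplacian (walk_prob s Y r) x - c * (?e r * (2 * s x / W))"
      by (simp add: harmonic[OF x] lap_\<phi>[OF x])
    finally have "laplacian (D r) x / (2 * s x) = laplacian (walk_prob s Y r) x / (2 * s x) - c * (?e r * (2 / (2 * W)))"
      using pos[of x] by (simp add: diff_divide_distrib)
    moreover have "c * (?e r * (\<phi> x / (2 * W))) \<le> c * (?e r * (2 / (2 * W)))"
      using \<open>0 < W\<close> \<open>0 \<le> c\<close> \<phi>_le[of x] by (intro mult_left_mono divide_right_mono) auto
    ultimately show "laplacian (D r) x / (2 * s x) \<le> D' r x"
      unfolding D'_def times_divide_eq_right[symmetric] by linarith
  next
    fix r assume r: "r \<in> {0..t}"
    have e: "0 \<le> ?e r * \<phi> y" if "y \<in> {A..B}" for y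
      using \<phi>_ge[OF that] by (intro mult_nonneg_nonneg) auto
    have "0 \<le> c * (?e r * \<phi> A)" "0 \<le> c * (?e r * \<phi> B)"
      using e x \<open>0 \<le> c\<close> by auto
    then show "0 \<le> D r A" "0 \<le> D r B"
      using bdA[OF r] bdB[OF r] by (auto simp: D_def algebra_simps)
  next
    fix x assume "x \<in> ?I"
    then have "h x - \<phi> x \<le> 0" using h_le[of x] \<phi>_ge[of x] by auto
    then have "c * (h x - \<phi> x) \<le> 0" using \<open>0 \<le> c\<close> by (simp add: mult_nonneg_nonpos)
    then show "0 \<le> D 0 x" using walk_prob_nonneg[of 0 Y x] by (simp add: D_def)
  qed (use assms in auto)
  moreover have "c * (?e t * \<phi> x) \<le> c * (?e t * 2)"
    using \<open>0 \<le> c\<close> \<phi>_le by (intro mult_left_mono) auto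
  ultimately show ?thesis by (simp add: D_def algebra_simps)
qed

text \<open>Each trap is bounded from below by the affine function that is 1 there and 0 at the
  other trap. The two affine functions add up to 1 and the two probabilities to at most 1, so the
  lower bounds become two-sided.\<close>

lemma BTM_prob_two_traps:
  fixes a :: nat
  assumes "0 \<le> t" "0 < a" and A: "A \<le> 0" and B: "0 < B" and "0 < W"
    and W: "real_of_int (B - A) * (\<Sum>z\<in>{A<..<B}. s z) \<le> W"
    and trap: "\<And>z. z \<in> {A, B} \<Longrightarrow> t / (a * s z) + (\<Sum>x\<in>{z - int a..z + int a} - {z}. s x) / s z \<le> \<rho>"
    and \<rho>: "\<rho> \<le> 1" "2 * exp (- t / (2 * W)) \<le> \<rho>"
  shows "\<bar>BTM_prob s t B + real_of_int \<bar>B\<bar> / real_of_int (\<bar>A\<bar> + \<bar>B\<bar>) - 1\<bar> \<le> 2 * \<rho>"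
    and "\<bar>BTM_prob s t A + real_of_int \<bar>A\<bar> / real_of_int (\<bar>A\<bar> + \<bar>B\<bar>) - 1\<bar> \<le> 2 * \<rho>"
proof -
  have \<rho>0: "0 \<le> \<rho>" using \<rho>(2) exp_ge_zero[of "- t / (2 * W)"] by linarith
  \<comment> \<open>The loss in the trap estimate grows with time, so the bound at \<open>t\<close>
    covers all earlier times, as the boundary condition of the exit estimate requires.\<close>
  have stay: "1 - \<rho> \<le> walk_prob s {z} r z" if z: "z \<in> {A, B}" and r: "r \<in> {0..t}" for z r
  proof -
    have "r / (a * s z) \<le> t / (a * s z)"
      using r pos[of z] by (intro divide_right_mono mult_nonneg_nonneg) auto
    then show ?thesis
      using walk_prob_trap_lower_bound[OF \<open>0 < a\<close>, of r z] trap[OF z] r by auto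
  qed
  have L: "real_of_int (B - A) > 0" using A B by simp
  have lower: "h 0 - 2 * \<rho> \<le> BTM_prob s t z"
    if z: "z \<in> {A, B}" and h: "\<And>x. x \<in> {A..B} \<Longrightarrow> 0 \<le> h x \<and> h x \<le> 1"
      and harm: "\<And>x. x \<in> {A<..<B} \<Longrightarrow> laplacian h x = 0"
      and other: "\<And>y. y \<in> {A, B} \<Longrightarrow> y \<noteq> z \<Longrightarrow> h y = 0" for z and h :: "int \<Rightarrow> real"
  proof -
    have bd: "(1 - \<rho>) * h y \<le> walk_prob s {z} r y" if "y \<in> {A, B}" "r \<in> {0..t}" for y r
    proof (cases "y = z")
      case True
      have "(1 - \<rho>) * h y \<le> (1 - \<rho>) * 1"
        using \<rho> h[of y] A B that by (intro mult_left_mono) auto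
      then show ?thesis using stay[OF z that(2)] True by simp
    next
      case False
      then show ?thesis using other[OF that(1)] walk_prob_nonneg that(2) by auto
    qed
    have h0: "0 \<le> h 0" "h 0 \<le> 1" using h[of 0] A B by auto
    \<comment> \<open>Reaching the trap costs \<open>\<rho>\<close> and staying there costs a factor
      \<open>1 - \<rho>\<close>; together they lose at most \<open>2 * \<rho>\<close>.\<close>
    have "(1 - \<rho>) * (h 0 - \<rho>) \<le> (1 - \<rho>) * (h 0 - 2 * exp (- t / (2 * W)))"
      using \<rho> by (intro mult_left_mono) auto
    also have "\<dots> \<le> walk_prob s {z} t 0"
    proof (rule walk_prob_exit_lower_bound[OF \<open>0 \<le> t\<close> _ _ \<open>0 < W\<close> W])
      show "h x \<le> 1" if "x \<in> {A..B}" for x using h[OF that] by simp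
      show "laplacian h x = 0" if "x \<in> {A<..<B}" for x by (rule harm[OF that])
      show "(1 - \<rho>) * h A \<le> walk_prob s {z} r A" "(1 - \<rho>) * h B \<le> walk_prob s {z} r B"
        if "r \<in> {0..t}" for r
        by (rule bd; use that in simp)+
    qed (use A B \<rho> in simp_all)
    finally have "(1 - \<rho>) * (h 0 - \<rho>) \<le> BTM_prob s t z"
      by (simp add: BTM_prob_eq_walk_prob)
    moreover have "(1 - \<rho>) * (h 0 - \<rho>) = h 0 - \<rho> - \<rho> * h 0 + \<rho> * \<rho>"
      by (simp add: algebra_simps)
    moreover have "\<rho> * h 0 \<le> \<rho> * 1" "0 \<le> \<rho> * \<rho>"
      by (rule mult_left_mono[OF h0(2) \<rho>0], rule mult_nonneg_nonneg[OF \<rho>0 \<rho>0])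
    ultimately show ?thesis by linarith
  qed
  have affine: "laplacian (\<lambda>x. (p + q * real_of_int x) / real_of_int (B - A)) x = 0" for p q x
    by (simp add: laplacian_def add_divide_distrib diff_divide_distrib distrib_left right_diff_distrib)
  have lowB: "(0 - A) / (B - A) - 2 * \<rho> \<le> BTM_prob s t B"
  proof -
    define h where "h x = (- real_of_int A + 1 * real_of_int x) / real_of_int (B - A)" for x
    have "h 0 - 2 * \<rho> \<le> BTM_prob s t B"
    proof (rule lower)
      show "laplacian h x = 0" for x
        unfolding h_def by (rule affine)
      show "0 \<le> h x \<and> h x \<le> 1" if "x \<in> {A..B}" for x
        using that L by (simp add: h_def)
      show "h y = 0" if "y \<in> {A, B}" "y \<noteq> B" for y
        using that by (simp add: h_def)
    qed simp
    then show ?thesis by (simp add: h_def)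
  qed
  have lowA: "(B - 0) / (B - A) - 2 * \<rho> \<le> BTM_prob s t A"
  proof -
    define h where "h x = (real_of_int B + (-1) * real_of_int x) / real_of_int (B - A)" for x
    have "h 0 - 2 * \<rho> \<le> BTM_prob s t A"
    proof (rule lower)
      show "laplacian h x = 0" for x
        unfolding h_def by (rule affine)
      show "0 \<le> h x \<and> h x \<le> 1" if "x \<in> {A..B}" for x
        using that L by (simp add: h_def)
      show "h y = 0" if "y \<in> {A, B}" "y \<noteq> A" for y
        using that by (simp add: h_def)
    qed simp
    then show ?thesis by (simp add: h_def)
  qed
  have le_1: "BTM_prob s t B + BTM_prob s t A \<le> 1"
    using walk_prob_insert[OF \<open>0 \<le> t\<close>, of B A 0] walk_prob_le_1[OF \<open>0 \<le> t\<close>, of "{B, A}" 0] A B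
    by (simp add: BTM_prob_eq_walk_prob)
  have eq_1: "real_of_int (0 - A) / (B - A) + real_of_int (B - 0) / (B - A) = 1"
    using L by (simp add: diff_divide_distrib[symmetric])
  \<comment> \<open>The nearer trap is the likelier one: the walk exits at \<open>B\<close> with
    probability |A| / (|A| + |B|), which is why adding |B| / (|A| + |B|) gives 1.\<close>
  have ratios: "real_of_int \<bar>B\<bar> / real_of_int (\<bar>A\<bar> + \<bar>B\<bar>) = real_of_int (B - 0) / (B - A)"
    "real_of_int \<bar>A\<bar> / real_of_int (\<bar>A\<bar> + \<bar>B\<bar>) = real_of_int (0 - A) / (B - A)"
    using A B by simp_all
  have squeeze: "\<bar>p + Y - 1\<bar> \<le> 2 * \<rho>"
    if "X - 2 * \<rho> \<le> p" "Y - 2 * \<rho> \<le> q" "p + q \<le> 1" "X + Y = 1" for p q X Y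
    using that by linarith
  show "\<bar>BTM_prob s t B + real_of_int \<bar>B\<bar> / real_of_int (\<bar>A\<bar> + \<bar>B\<bar>) - 1\<bar> \<le> 2 * \<rho>"
    unfolding ratios by (rule squeeze[OF lowB lowA le_1 eq_1])
  show "\<bar>BTM_prob s t A + real_of_int \<bar>A\<bar> / real_of_int (\<bar>A\<bar> + \<bar>B\<bar>) - 1\<bar> \<le> 2 * \<rho>"
    unfolding ratios by (rule squeeze[OF lowA lowB le_1[unfolded add.commute[of "BTM_prob s t B"]] eq_1[unfolded add.commute[of "real_of_int (0 - A) / _"]]])
qed

end

text \<open>The deterministic half of the argument. Both traps lie within distance \<open>m\<close>
  of the origin and \<open>a \<le> m\<close>, so a window of radius \<open>2 * m\<close> contains
  their neighbourhoods of radius \<open>a\<close>.\<close>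

lemma (in landscape) BTM_prob_good_environment:
  fixes a m :: nat and l t \<eta> K \<theta> \<rho> :: real
  assumes l: "0 < l" and "0 < a" "a \<le> m" and "\<eta> \<le> 1" "1 \<le> K" "0 < \<theta>" "0 < t"
    and right: "\<exists>n\<in>{1..m}. l < s (int n)" and left: "\<exists>n\<in>{1..m}. l < s (- int n)"
    and gap: "\<And>z. z \<in> {-2 * int m..2 * int m} \<Longrightarrow> s z \<le> \<eta> * l \<or> K * l < s z"
    and small: "(\<Sum>z\<in>{-2 * int m..2 * int m}. if s z \<le> \<eta> * l then s z else 0) \<le> \<theta> * l"
    and apart: "\<And>x y. x \<in> {-2 * int m..2 * int m} \<Longrightarrow> y \<in> {-2 * int m..2 * int m} \<Longrightarrow>
      x < y \<Longrightarrow> y - x \<le> int a \<Longrightarrow> l < s x \<Longrightarrow> s y \<le> l"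
    and \<rho>: "t / (a * (K * l)) + \<theta> \<le> \<rho>" "8 * real m * \<theta> * l / t \<le> \<rho>" "\<rho> \<le> 1"
    and Z: "Z \<in> Gamma_set s l"
  shows "\<bar>BTM_prob s t Z + real_of_int \<bar>Z\<bar> / real_of_int (\<Sum>z\<in>Gamma_set s l. \<bar>z\<bar>) - 1\<bar> \<le> 2 * \<rho>"
proof -
  let ?F = "{-2 * int m..2 * int m}"
  define B where "B = Z1 s l"
  define A where "A = Z2 s l"
  have Kl: "l \<le> K * l" using l \<open>1 \<le> K\<close> by simp
  define b where "b = (LEAST n::nat. 0 < n \<and> l < s (int n))"
  have b: "0 < b" "l < s (int b)" "b \<le> m"
    and b_least: "\<And>n. 0 < n \<Longrightarrow> n < b \<Longrightarrow> s (int n) \<le> l"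
  proof -
    obtain n where n: "n \<in> {1..m}" "l < s (int n)" using right by blast
    then have "0 < n \<and> l < s (int n)" by simp
    from LeastI[of "\<lambda>n. 0 < n \<and> l < s (int n)", OF this] Least_le[of "\<lambda>n. 0 < n \<and> l < s (int n)", OF this] n
    show "0 < b" "l < s (int b)" "b \<le> m" by (auto simp: b_def)
    show "s (int n) \<le> l" if "0 < n" "n < b" for n
      using not_less_Least[of n "\<lambda>n. 0 < n \<and> l < s (int n)"] that by (auto simp: b_def not_less)
  qed
  \<comment> \<open>The search on the left begins at the origin itself, so \<open>c = 0\<close> may
    occur.\<close>
  define c where "c = (LEAST n::nat. l < s (- int n))"
  have c: "l < s (- int c)" "c \<le> m"
    and c_least: "\<And>n. n < c \<Longrightarrow> s (- int n) \<le> l"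
  proof -
    obtain n where n: "n \<in> {1..m}" "l < s (- int n)" using left by blast
    from LeastI[of "\<lambda>n. l < s (- int n)", OF n(2)] Least_le[of "\<lambda>n. l < s (- int n)", OF n(2)] n
    show "l < s (- int c)" "c \<le> m" by (auto simp: c_def)
    show "s (- int n) \<le> l" if "n < c" for n
      using not_less_Least[of n "\<lambda>n. l < s (- int n)"] that by (auto simp: c_def not_less)
  qed
  have B: "B = int b" and A: "A = - int c"
    by (simp_all add: B_def A_def Z1_def Z2_def b_def c_def)
  have inner: "s z \<le> l" if "z \<in> {A<..<B}" for z
  proof (cases "0 < z")
    case True
    then show ?thesis using b_least[of "nat z"] that by (simp add: B nat_less_iff)
  next
    case False
    then show ?thesis using c_least[of "nat (- z)"] that by (simp add: A nat_less_iff)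
  qed
  \<comment> \<open>By the gap condition a site of depth at most \<open>l\<close> has depth at most
    \<open>\<eta> * l\<close>, so the truncated sum controls it. Conversely, depths above
    \<open>l\<close> exceed \<open>K * l\<close>.\<close>
  have sum_small: "(\<Sum>z\<in>X. s z) \<le> \<theta> * l" if "X \<subseteq> ?F" and X: "\<And>z. z \<in> X \<Longrightarrow> s z \<le> l" for X
  proof -
    have "(\<Sum>z\<in>X. s z) = (\<Sum>z\<in>X. if s z \<le> \<eta> * l then s z else 0)"
    proof (rule sum.cong)
      fix z assume "z \<in> X"
      then have "s z \<le> \<eta> * l" using gap[of z] X[of z] Kl that(1) by force
      then show "s z = (if s z \<le> \<eta> * l then s z else 0)" by simp
    qed simp
    also have "\<dots> \<le> (\<Sum>z\<in>?F. if s z \<le> \<eta> * l then s z else 0)"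
      using that(1) pos by (intro sum_mono2) (auto intro: less_imp_le)
    finally show ?thesis using small by linarith
  qed
  have trap: "t / (a * s z) + (\<Sum>x\<in>{z - int a..z + int a} - {z}. s x) / s z \<le> \<rho>" if "z \<in> {A, B}" for z
  proof -
    have z: "l < s z" "z \<in> {- int m..int m}" using that b c by (auto simp: A B)
    have zF: "z \<in> ?F" using z by auto
    have sz: "K * l < s z"
    proof -
      have "\<eta> * l \<le> l" using l \<open>\<eta> \<le> 1\<close> by simp
      then show ?thesis using gap[OF zF] z by linarith
    qed
    have "(\<Sum>x\<in>{z - int a..z + int a} - {z}. s x) \<le> \<theta> * l"
    proof (rule sum_small)
      show "{z - int a..z + int a} - {z} \<subseteq> ?F" using z \<open>a \<le> m\<close> by auto
      fix x assume x: "x \<in> {z - int a..z + int a} - {z}"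
      then have xF: "x \<in> ?F" using z \<open>a \<le> m\<close> by auto
      show "s x \<le> l"
        using apart[OF xF zF] apart[OF zF xF] x z(1) by (cases "x < z") force+
    qed
    then have "(\<Sum>x\<in>{z - int a..z + int a} - {z}. s x) / s z \<le> \<theta> * l / s z"
      using pos[of z] by (intro divide_right_mono) auto
    also have "\<dots> \<le> \<theta> * l / l"
      using z l \<open>0 < \<theta>\<close> by (intro divide_left_mono mult_nonneg_nonneg mult_pos_pos) auto
    also have "\<dots> = \<theta>" using l by simp
    finally have 1: "(\<Sum>x\<in>{z - int a..z + int a} - {z}. s x) / s z \<le> \<theta>" .
    have "t / (a * s z) \<le> t / (a * (K * l))"
    proof (rule divide_left_mono)
      show "a * (K * l) \<le> a * s z" using sz by (intro mult_left_mono) auto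
      show "0 < a * s z * (a * (K * l))" using pos[of z] \<open>0 < a\<close> l \<open>1 \<le> K\<close> by (intro mult_pos_pos) auto
    qed (use \<open>0 < t\<close> in simp)
    with 1 \<rho>(1) show ?thesis by linarith
  qed
  define W where "W = 2 * real m * \<theta> * l"
  have "0 < m" using \<open>0 < a\<close> \<open>a \<le> m\<close> by simp
  then have W0: "0 < W" unfolding W_def using l \<open>0 < \<theta>\<close> by (intro mult_pos_pos) auto
  have W: "real_of_int (B - A) * (\<Sum>z\<in>{A<..<B}. s z) \<le> W"
  proof -
    have "(\<Sum>z\<in>{A<..<B}. s z) \<le> \<theta> * l"
      by (rule sum_small) (use b c inner in \<open>auto simp: A B\<close>)
    moreover have "real_of_int (B - A) \<le> 2 * real m" using b c by (simp add: A B)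
    moreover have "0 \<le> (\<Sum>z\<in>{A<..<B}. s z)" by (intro sum_nonneg less_imp_le[OF pos])
    ultimately have "real_of_int (B - A) * (\<Sum>z\<in>{A<..<B}. s z) \<le> (2 * real m) * (\<theta> * l)"
      by (intro mult_mono) auto
    then show ?thesis by (simp add: W_def mult_ac)
  qed
  \<comment> \<open>From \<open>exp (- y) \<le> 1 / y\<close> at \<open>y = t / (2 * W)\<close>; the
    resulting \<open>4 * W / t\<close> is the quantity bounded by assumption.\<close>
  have e: "2 * exp (- t / (2 * W)) \<le> \<rho>"
  proof -
    have "0 < t / (2 * W)" using W0 \<open>0 < t\<close> by simp
    moreover have "t / (2 * W) \<le> exp (t / (2 * W))" using exp_ge_add_one_self[of "t / (2 * W)"] by linarith
    ultimately have "inverse (exp (t / (2 * W))) \<le> inverse (t / (2 * W))"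
      by (intro le_imp_inverse_le)
    also have "inverse (t / (2 * W)) = 2 * W / t" by simp
    finally have "2 * exp (- t / (2 * W)) \<le> 2 * (2 * W / t)" by (simp add: exp_minus)
    also have "\<dots> = 8 * real m * \<theta> * l / t" by (simp add: W_def)
    finally show ?thesis using \<rho>(2) by linarith
  qed
  have "\<bar>BTM_prob s t B + real_of_int \<bar>B\<bar> / real_of_int (\<bar>A\<bar> + \<bar>B\<bar>) - 1\<bar> \<le> 2 * \<rho>"
    and "\<bar>BTM_prob s t A + real_of_int \<bar>A\<bar> / real_of_int (\<bar>A\<bar> + \<bar>B\<bar>) - 1\<bar> \<le> 2 * \<rho>"
    using BTM_prob_two_traps[OF less_imp_le[OF \<open>0 < t\<close>] \<open>0 < a\<close> _ _ W0 W trap \<rho>(3) e] b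
    by (simp_all add: A B)
  moreover have "(\<Sum>z\<in>Gamma_set s l. \<bar>z\<bar>) = \<bar>A\<bar> + \<bar>B\<bar>"
    using b by (simp add: Gamma_set_def A_def[symmetric] B_def[symmetric] A B)
  moreover have "Z = A \<or> Z = B"
    using Z by (auto simp: Gamma_set_def A_def B_def)
  ultimately show ?thesis by auto
qed

subsection \<open>Traps in a random landscape\<close>

locale iid_traps = prob_space M for M :: "'a measure" +
  fixes \<sigma> :: "'a \<Rightarrow> int \<Rightarrow> real"
  assumes indep: "indep_vars (\<lambda>_. borel) (\<lambda>z \<omega>. \<sigma> \<omega> z) UNIV"
    and ident: "\<And>z. distr M borel (\<lambda>\<omega>. \<sigma> \<omega> z) = distr M borel (\<lambda>\<omega>. \<sigma> \<omega> 0)"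
    and positive: "\<And>\<omega> z. 0 < \<sigma> \<omega> z"
begin

section \<open>One-site tails and truncated means\<close>

definition tail :: "real \<Rightarrow> real" where
  "tail x = prob {\<omega> \<in> space M. x < \<sigma> \<omega> 0}"

definition truncated_mean :: "real \<Rightarrow> real" where
  "truncated_mean x = expectation (\<lambda>\<omega>. if \<sigma> \<omega> 0 \<le> x then \<sigma> \<omega> 0 else 0)"

lemma trap_measurable [measurable]: "(\<lambda>\<omega>. \<sigma> \<omega> z) \<in> borel_measurable M"
  using indep by (simp add: indep_vars_def)

lemma prob_trap:
  assumes "A \<in> sets borel"
  shows "prob {\<omega> \<in> space M. \<sigma> \<omega> z \<in> A} = prob {\<omega> \<in> space M. \<sigma> \<omega> 0 \<in> A}"
proof -
  have "prob {\<omega> \<in> space M. \<sigma> \<omega> z \<in> A} = measure (distr M borel (\<lambda>\<omega>. \<sigma> \<omega> z)) A" for z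
    using assms by (simp add: measure_distr vimage_def Int_def conj_commute)
  then show ?thesis by (simp only: ident[of z])
qed

lemma prob_trap_gt: "prob {\<omega> \<in> space M. x < \<sigma> \<omega> z} = tail x"
  using prob_trap[of "{x<..}" z] by (simp add: tail_def)

lemma prob_trap_le: "prob {\<omega> \<in> space M. \<sigma> \<omega> z \<le> x} = 1 - tail x"
proof -
  have "prob {\<omega> \<in> space M. \<not> x < \<sigma> \<omega> z} = 1 - prob {\<omega> \<in> space M. x < \<sigma> \<omega> z}"
    by (rule prob_neg) measurable
  then show ?thesis by (simp add: not_less prob_trap_gt)
qed

lemma prob_trap_between:
  assumes "x \<le> y"
  shows "prob {\<omega> \<in> space M. x < \<sigma> \<omega> z \<and> \<sigma> \<omega> z \<le> y} = tail x - tail y"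
proof -
  have "{\<omega> \<in> space M. x < \<sigma> \<omega> z \<and> \<sigma> \<omega> z \<le> y}
      = {\<omega> \<in> space M. x < \<sigma> \<omega> z} - {\<omega> \<in> space M. y < \<sigma> \<omega> z}" by auto
  moreover have "prob ({\<omega> \<in> space M. x < \<sigma> \<omega> z} - {\<omega> \<in> space M. y < \<sigma> \<omega> z})
      = prob {\<omega> \<in> space M. x < \<sigma> \<omega> z} - prob {\<omega> \<in> space M. y < \<sigma> \<omega> z}"
    using assms by (intro finite_measure_Diff) auto
  ultimately show ?thesis by (simp add: prob_trap_gt)
qed

lemma tail_nonneg: "0 \<le> tail x" and tail_le_1: "tail x \<le> 1"
  by (simp_all add: tail_def)

lemma tail_antimono: "x \<le> y \<Longrightarrow> tail y \<le> tail x"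
  unfolding tail_def by (intro finite_measure_mono) auto

lemma tail_tendsto_0: "(tail \<longlongrightarrow> 0) at_top"
proof -
  interpret D: real_distribution "distr M borel (\<lambda>\<omega>. \<sigma> \<omega> 0)"
    by (rule real_distribution_distr) measurable
  have "cdf (distr M borel (\<lambda>\<omega>. \<sigma> \<omega> 0)) x = 1 - tail x" for x
    using prob_trap_le[of 0 x] by (simp add: cdf_def measure_distr vimage_def Int_def conj_commute)
  then have "((\<lambda>x. 1 - tail x) \<longlongrightarrow> 1) at_top"
    using D.cdf_lim_at_top_prob by presburger
  then have "((\<lambda>x. 1 - (1 - tail x)) \<longlongrightarrow> 1 - 1) at_top"
    by (intro tendsto_intros)
  then show ?thesis by simp
qed

lemma integrable_truncated: "integrable M (\<lambda>\<omega>. if \<sigma> \<omega> z \<le> x then \<sigma> \<omega> z else 0)"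
  by (rule integrable_const_bound[where B = "\<bar>x\<bar>"]) (auto simp: less_imp_le[OF positive])

lemma expectation_truncated:
  "expectation (\<lambda>\<omega>. if \<sigma> \<omega> z \<le> x then \<sigma> \<omega> z else 0) = truncated_mean x"
proof -
  have "expectation (\<lambda>\<omega>. if \<sigma> \<omega> z \<le> x then \<sigma> \<omega> z else 0)
      = (\<integral>y. (if y \<le> x then y else 0) \<partial>distr M borel (\<lambda>\<omega>. \<sigma> \<omega> z))" for z
    by (subst integral_distr) auto
  then show ?thesis by (simp only: ident[of z] truncated_mean_def)
qed

lemma truncated_mean_le: "0 \<le> x \<Longrightarrow> truncated_mean x \<le> x"
  unfolding truncated_mean_def
  by (rule order_trans[OF integral_mono[where g = "\<lambda>_. x"]]) (auto intro: integrable_truncated simp: prob_space)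

text \<open>Only depths between \<open>x\<close> and \<open>2 * x\<close> are new, and each
  contributes at most \<open>2 * x\<close>.\<close>

lemma truncated_mean_double:
  assumes "0 \<le> x"
  shows "truncated_mean (2 * x) \<le> truncated_mean x + 2 * x * tail x"
proof -
  let ?f = "\<lambda>\<omega>. if \<sigma> \<omega> 0 \<le> x then \<sigma> \<omega> 0 else 0"
  let ?g = "\<lambda>\<omega>. 2 * x * indicator {\<omega> \<in> space M. x < \<sigma> \<omega> 0} \<omega>"
  have g: "integrable M ?g"
    by (intro integrable_mult_right integrable_real_indicator) (auto simp: emeasure_eq_measure)
  have "truncated_mean (2 * x) \<le> expectation (\<lambda>\<omega>. ?f \<omega> + ?g \<omega>)"
    unfolding truncated_mean_def
    using assms by (intro integral_mono integrable_truncated Bochner_Integration.integrable_add g) (auto simp: indicator_def)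
  also have "\<dots> = expectation ?f + expectation ?g"
    by (rule Bochner_Integration.integral_add[OF integrable_truncated g])
  also have "\<dots> = truncated_mean x + 2 * x * tail x"
    by (simp add: truncated_mean_def tail_def)
  finally show ?thesis .
qed

text \<open>Independence gives a power of \<open>1 - tail x\<close>, which is at most
  \<open>exp (- tail x)\<close>. A range of length R / \<open>tail x\<close> therefore misses all
  traps with probability at most exp(-R).\<close>

lemma prob_no_trap_gt:
  assumes J: "finite J" "J \<noteq> {}"
  shows "prob {\<omega> \<in> space M. \<forall>z\<in>J. \<sigma> \<omega> z \<le> x} \<le> exp (- (card J * tail x))"
proof -
  have "prob (\<Inter>z\<in>J. (\<lambda>\<omega>. \<sigma> \<omega> z) -` {..x} \<inter> space M) = (\<Prod>z\<in>J. prob ((\<lambda>\<omega>. \<sigma> \<omega> z) -` {..x} \<inter> space M))"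
    using J by (intro indep_varsD[OF indep]) auto
  also have "(\<Inter>z\<in>J. (\<lambda>\<omega>. \<sigma> \<omega> z) -` {..x} \<inter> space M) = {\<omega> \<in> space M. \<forall>z\<in>J. \<sigma> \<omega> z \<le> x}"
    using J by auto
  also have "(\<lambda>z. prob ((\<lambda>\<omega>. \<sigma> \<omega> z) -` {..x} \<inter> space M)) = (\<lambda>_. 1 - tail x)"
    using prob_trap_le by (simp add: vimage_def Int_def conj_commute)
  also have "(\<Prod>z\<in>J. 1 - tail x) = (1 - tail x) ^ card J" by simp
  also have "\<dots> \<le> exp (- tail x) ^ card J"
    using tail_le_1[of x] exp_ge_add_one_self[of "- tail x"] by (intro power_mono) auto
  also have "\<dots> = exp (- (card J * tail x))"
    by (simp add: exp_of_nat_mult[symmetric])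
  finally show ?thesis .
qed

lemma prob_two_traps_gt:
  assumes "z \<noteq> w"
  shows "prob {\<omega> \<in> space M. x < \<sigma> \<omega> z \<and> x < \<sigma> \<omega> w} = tail x * tail x"
proof -
  have "prob (\<Inter>z\<in>{z, w}. (\<lambda>\<omega>. \<sigma> \<omega> z) -` {x<..} \<inter> space M) = (\<Prod>z\<in>{z, w}. prob ((\<lambda>\<omega>. \<sigma> \<omega> z) -` {x<..} \<inter> space M))"
    by (intro indep_varsD[OF indep]) auto
  also have "(\<Inter>z\<in>{z, w}. (\<lambda>\<omega>. \<sigma> \<omega> z) -` {x<..} \<inter> space M) = {\<omega> \<in> space M. x < \<sigma> \<omega> z \<and> x < \<sigma> \<omega> w}"
    by auto
  also have "(\<lambda>z. prob ((\<lambda>\<omega>. \<sigma> \<omega> z) -` {x<..} \<inter> space M)) = (\<lambda>_. tail x)"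
    using prob_trap_gt by (simp add: vimage_def Int_def conj_commute)
  finally show ?thesis using assms by simp
qed

section \<open>Probabilities of bad landscapes\<close>

lemma prob_UN_le_card:
  fixes q :: real
  assumes "finite J" "\<And>j. j \<in> J \<Longrightarrow> E j \<in> events" "\<And>j. j \<in> J \<Longrightarrow> prob (E j) \<le> q"
  shows "prob (\<Union>j\<in>J. E j) \<le> card J * q"
proof -
  have "prob (\<Union>j\<in>J. E j) \<le> (\<Sum>j\<in>J. prob (E j))"
    using assms by (intro finite_measure_subadditive_finite) auto
  also have "\<dots> \<le> card J * q"
    using sum_bounded_above[of J "\<lambda>j. prob (E j)" q] assms(3) by simp
  finally show ?thesis .
qed

lemma prob_trap_between_some:
  assumes "finite J" "x \<le> y"
  shows "prob {\<omega> \<in> space M. \<exists>z\<in>J. x < \<sigma> \<omega> z \<and> \<sigma> \<omega> z \<le> y} \<le> card J * (tail x - tail y)"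
proof -
  have "{\<omega> \<in> space M. \<exists>z\<in>J. x < \<sigma> \<omega> z \<and> \<sigma> \<omega> z \<le> y} = (\<Union>z\<in>J. {\<omega> \<in> space M. x < \<sigma> \<omega> z \<and> \<sigma> \<omega> z \<le> y})"
    by auto
  moreover have "prob (\<Union>z\<in>J. {\<omega> \<in> space M. x < \<sigma> \<omega> z \<and> \<sigma> \<omega> z \<le> y}) \<le> card J * (tail x - tail y)"
    by (rule prob_UN_le_card[OF \<open>finite J\<close>]) (auto simp: prob_trap_between[OF \<open>x \<le> y\<close>])
  ultimately show ?thesis by simp
qed

lemma prob_close_traps:
  fixes a :: nat
  assumes "finite J"
  shows "prob {\<omega> \<in> space M. \<exists>z\<in>J. \<exists>d\<in>{1..a}. x < \<sigma> \<omega> z \<and> x < \<sigma> \<omega> (z + int d)} \<le> card J * a * (tail x * tail x)"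
proof -
  have "{\<omega> \<in> space M. \<exists>z\<in>J. \<exists>d\<in>{1..a}. x < \<sigma> \<omega> z \<and> x < \<sigma> \<omega> (z + int d)}
      = (\<Union>(z, d)\<in>J \<times> {1..a}. {\<omega> \<in> space M. x < \<sigma> \<omega> z \<and> x < \<sigma> \<omega> (z + int d)})"
    by auto
  moreover have "prob (\<Union>(z, d)\<in>J \<times> {1..a}. {\<omega> \<in> space M. x < \<sigma> \<omega> z \<and> x < \<sigma> \<omega> (z + int d)})
     \<le> card (J \<times> {1..a}) * (tail x * tail x)"
    by (rule prob_UN_le_card) (use assms in \<open>auto simp: prob_two_traps_gt\<close>)
  ultimately show ?thesis by (simp add: card_cartesian_product)
qed

lemma prob_sum_truncated:
  assumes "finite J" "0 < c"
  shows "prob {\<omega> \<in> space M. c \<le> (\<Sum>z\<in>J. if \<sigma> \<omega> z \<le> x then \<sigma> \<omega> z else 0)} \<le> card J * truncated_mean x / c"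
proof -
  have "prob {\<omega> \<in> space M. c \<le> (\<Sum>z\<in>J. if \<sigma> \<omega> z \<le> x then \<sigma> \<omega> z else 0)}
     \<le> expectation (\<lambda>\<omega>. \<Sum>z\<in>J. if \<sigma> \<omega> z \<le> x then \<sigma> \<omega> z else 0) / c"
    using assms
    by (intro integral_Markov_inequality_measure[where A = "{}"] Bochner_Integration.integrable_sum integrable_truncated)
       (auto intro!: sum_nonneg less_imp_le[OF positive])
  also have "expectation (\<lambda>\<omega>. \<Sum>z\<in>J. if \<sigma> \<omega> z \<le> x then \<sigma> \<omega> z else 0) = card J * truncated_mean x"
    by (subst Bochner_Integration.integral_sum) (auto intro: integrable_truncated simp: expectation_truncated)
  finally show ?thesis .
qed

text \<open>The landscape conditions of \<open>BTM_prob_good_environment\<close>. Separation is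
  phrased through the distance \<open>d\<close> so that a union bound over pairs applies, and the
  strict bound on the sum is the complement of a Markov event.\<close>

definition good_event :: "nat \<Rightarrow> nat \<Rightarrow> real \<Rightarrow> real \<Rightarrow> real \<Rightarrow> real \<Rightarrow> 'a set" where
  "good_event m a \<eta> K \<theta> l = {\<omega> \<in> space M.
     (\<exists>n\<in>{1..m}. l < \<sigma> \<omega> (int n)) \<and> (\<exists>n\<in>{1..m}. l < \<sigma> \<omega> (- int n)) \<and>
     (\<forall>z\<in>{-2 * int m..2 * int m}. \<sigma> \<omega> z \<le> \<eta> * l \<or> K * l < \<sigma> \<omega> z) \<and>
     (\<Sum>z\<in>{-2 * int m..2 * int m}. if \<sigma> \<omega> z \<le> \<eta> * l then \<sigma> \<omega> z else 0) < \<theta> * l \<and>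
     (\<forall>z\<in>{-2 * int m..2 * int m}. \<forall>d\<in>{1..a}. \<not> (l < \<sigma> \<omega> z \<and> l < \<sigma> \<omega> (z + int d)))}"

lemma good_event_measurable: "good_event m a \<eta> K \<theta> l \<in> events"
  unfolding good_event_def by measurable

text \<open>Union bound over five failures: no trap on the right, none on the left, a depth in the
  gap, too much shallow depth, two deep traps close together. The window has
  \<open>4 * m + 1\<close> sites.\<close>

lemma prob_good_event:
  assumes "0 < m" "0 < l" "0 < \<theta>" "\<eta> \<le> K"
  shows "1 - (2 * exp (- (m * tail l)) + real (4 * m + 1) * (tail (\<eta> * l) - tail (K * l))
      + real (4 * m + 1) * truncated_mean (\<eta> * l) / (\<theta> * l) + real ((4 * m + 1) * a) * (tail l * tail l))
    \<le> prob (good_event m a \<eta> K \<theta> l)"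
proof -
  let ?F = "{-2 * int m..2 * int m}" and ?P = "int ` {1..m}" and ?N = "(\<lambda>n. - int n) ` {1..m}"
  have cF: "card ?F = 4 * m + 1" by simp
  have cP: "card ?P = m" by (subst card_image) auto
  have cN: "card ?N = m" by (subst card_image) (auto simp: inj_on_def)
  define B1 where "B1 = {\<omega> \<in> space M. \<forall>z\<in>?P. \<sigma> \<omega> z \<le> l}"
  define B2 where "B2 = {\<omega> \<in> space M. \<forall>z\<in>?N. \<sigma> \<omega> z \<le> l}"
  define B3 where "B3 = {\<omega> \<in> space M. \<exists>z\<in>?F. \<eta> * l < \<sigma> \<omega> z \<and> \<sigma> \<omega> z \<le> K * l}"
  define B4 where "B4 = {\<omega> \<in> space M. \<theta> * l \<le> (\<Sum>z\<in>?F. if \<sigma> \<omega> z \<le> \<eta> * l then \<sigma> \<omega> z else 0)}"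
  define B5 where "B5 = {\<omega> \<in> space M. \<exists>z\<in>?F. \<exists>d\<in>{1..a}. l < \<sigma> \<omega> z \<and> l < \<sigma> \<omega> (z + int d)}"
  have [measurable]: "B1 \<in> events" "B2 \<in> events" "B3 \<in> events" "B4 \<in> events" "B5 \<in> events"
    unfolding B1_def B2_def B3_def B4_def B5_def by measurable
  have "prob B1 \<le> exp (- (m * tail l))" "prob B2 \<le> exp (- (m * tail l))"
    using prob_no_trap_gt[of ?P l] prob_no_trap_gt[of ?N l] \<open>0 < m\<close>
    by (simp_all only: B1_def B2_def cP cN) auto
  moreover have "prob B3 \<le> real (4 * m + 1) * (tail (\<eta> * l) - tail (K * l))"
    using prob_trap_between_some[OF _ mult_right_mono[OF \<open>\<eta> \<le> K\<close> less_imp_le[OF \<open>0 < l\<close>]], of ?F]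
    by (simp only: B3_def cF) simp
  moreover have "prob B4 \<le> real (4 * m + 1) * truncated_mean (\<eta> * l) / (\<theta> * l)"
    using prob_sum_truncated[of ?F "\<theta> * l" "\<eta> * l"] assms by (simp only: B4_def cF) simp
  moreover have "prob B5 \<le> real ((4 * m + 1) * a) * (tail l * tail l)"
    using prob_close_traps[of ?F a l] by (simp only: B5_def cF) simp
  moreover have "prob (B1 \<union> B2 \<union> B3 \<union> B4 \<union> B5) \<le> prob B1 + prob B2 + prob B3 + prob B4 + prob B5"
    by (intro order_trans[OF measure_Un_le] add_mono order_refl) auto
  moreover have "1 - prob (B1 \<union> B2 \<union> B3 \<union> B4 \<union> B5) \<le> prob (good_event m a \<eta> K \<theta> l)"
  proof -
    have "space M - (B1 \<union> B2 \<union> B3 \<union> B4 \<union> B5) \<subseteq> good_event m a \<eta> K \<theta> l"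
      unfolding good_event_def B1_def B2_def B3_def B4_def B5_def not_le[symmetric] by blast
    then have "prob (space M - (B1 \<union> B2 \<union> B3 \<union> B4 \<union> B5)) \<le> prob (good_event m a \<eta> K \<theta> l)"
      by (intro finite_measure_mono good_event_measurable)
    then show ?thesis by (subst (asm) prob_compl) auto
  qed
  ultimately show ?thesis by linarith
qed

end

subsection \<open>Slowly varying tails\<close>

locale slowly_varying_traps = iid_traps +
  assumes slow: "slowly_varying (\<lambda>x. 1 / tail x)"
begin

lemma tail_ratio_tendsto:
  assumes "0 < v"
  shows "((\<lambda>u. tail u / tail (u * v)) \<longlongrightarrow> 1) at_top"
  using slow assms unfolding slowly_varying_def by simp

text \<open>Division by zero yields 0, so a vanishing tail would make the ratio 0 far out, against
  its limit 1.\<close>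

lemma tail_pos: "0 < tail x"
proof -
  have "\<forall>\<^sub>F u in at_top. 1/2 < tail u / tail (u * 1)"
    by (rule order_tendstoD(1)[OF tail_ratio_tendsto]) auto
  moreover have "\<forall>\<^sub>F u in at_top. x \<le> u"
    by (rule eventually_ge_at_top)
  ultimately have "\<forall>\<^sub>F u in at_top. 1/2 < tail u / tail (u * 1) \<and> x \<le> u"
    by eventually_elim auto
  then obtain u where u: "1/2 < tail u / tail (u * 1)" "x \<le> u"
    using eventually_happens'[OF trivial_limit_at_top_linorder] by blast
  then have "tail u \<noteq> 0" by auto
  then show ?thesis using tail_nonneg[of u] tail_antimono[OF u(2)] by linarith
qed

lemma tail_ratio_le:
  assumes "0 < v" "1 < c"
  shows "\<forall>\<^sub>F u in at_top. tail u \<le> c * tail (u * v)" "\<forall>\<^sub>F u in at_top. tail (u * v) \<le> c * tail u"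
proof -
  have "\<forall>\<^sub>F u in at_top. tail u / tail (u * v) < c"
    by (rule order_tendstoD(2)[OF tail_ratio_tendsto[OF assms(1)] assms(2)])
  then show "\<forall>\<^sub>F u in at_top. tail u \<le> c * tail (u * v)"
    by eventually_elim (simp add: pos_divide_less_eq tail_pos)
  have "\<forall>\<^sub>F u in at_top. 1 / c < tail u / tail (u * v)"
    using assms by (intro order_tendstoD(1)[OF tail_ratio_tendsto]) auto
  then show "\<forall>\<^sub>F u in at_top. tail (u * v) \<le> c * tail u"
    by eventually_elim (use assms in \<open>simp add: field_simps tail_pos\<close>)
qed

text \<open>Among the order of \<open>1 / tail u\<close> sites one expects no depth between two
  fixed multiples of \<open>u\<close>; this creates the gap between shallow sites and traps.\<close>

lemma tail_difference_ratio_tendsto: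
  assumes "0 < v" "0 < w"
  shows "((\<lambda>u. (tail (v * u) - tail (w * u)) / tail u) \<longlongrightarrow> 0) at_top"
proof -
  have "((\<lambda>u. inverse (tail u / tail (u * v)) - inverse (tail u / tail (u * w))) \<longlongrightarrow> inverse 1 - inverse 1) at_top"
    using assms by (intro tendsto_intros tail_ratio_tendsto) auto
  then show ?thesis
    by (simp add: diff_divide_distrib mult.commute)
qed

text \<open>
  Doubling \<open>x\<close> multiplies \<open>truncated_mean x / (x * tail x)\<close> by a factor close to \<open>1/2\<close> and adds at most a
  constant, hence this quotient stays bounded.
\<close>

lemma truncated_mean_bound:
  "\<exists>C>0. \<exists>u>0. \<forall>x\<ge>u. truncated_mean x \<le> C * (x * tail x)"
proof -
  obtain u1 where u1: "\<And>x. u1 \<le> x \<Longrightarrow> tail x \<le> 3/2 * tail (x * 2)"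
    using tail_ratio_le(1)[of 2 "3/2"] by (auto simp: eventually_at_top_linorder)
  define u where "u = max 1 u1"
  have u: "0 < u" "\<And>x. u \<le> x \<Longrightarrow> tail x \<le> 3/2 * tail (2 * x)"
    using u1 by (auto simp: u_def mult.commute)
  \<comment> \<open>The value 6 makes \<open>3/4 * (C + 2) \<le> C\<close>, which closes the
    doubling step; the factor 3/4 is the tail ratio 3/2 times the halving of \<open>x\<close>. The
    second entry handles \<open>{u..2 * u}\<close>, where the truncated mean is at most
    \<open>x\<close>.\<close>
  define C where "C = max 6 (1 / tail (2 * u))"
  have C: "6 \<le> C" "1 \<le> C * tail (2 * u)"
    using tail_pos[of "2 * u"] by (auto simp: C_def max_def field_simps)
  have base: "truncated_mean x \<le> C * (x * tail x)" if "u \<le> x" "x \<le> 2 * u" for x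
  proof -
    have "truncated_mean x \<le> x" using that u by (intro truncated_mean_le) auto
    also have "x * 1 \<le> x * (C * tail (2 * u))"
      using C that u by (intro mult_left_mono) auto
    also have "\<dots> \<le> x * (C * tail x)"
      using that u C tail_antimono[OF that(2)] by (intro mult_left_mono) auto
    finally show ?thesis by (simp add: mult_ac)
  qed
  have step: "truncated_mean x \<le> C * (x * tail x)" if "u \<le> x" "x \<le> 2 ^ n * (2 * u)" for n x
    using that
  proof (induction n arbitrary: x)
    case 0
    then show ?case using base by simp
  next
    case (Suc n)
    show ?case
    proof (cases "x \<le> 2 * u")
      case True
      then show ?thesis using Suc.prems base by simp
    next
      case False
      define y where "y = x / 2"
      have y: "u \<le> y" "y \<le> 2 ^ n * (2 * u)" "x = 2 * y" "0 \<le> y"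
        using False Suc.prems u by (auto simp: y_def)
      have "truncated_mean x \<le> truncated_mean y + 2 * y * tail y"
        using truncated_mean_double[OF y(4)] y by simp
      also have "\<dots> \<le> C * (y * tail y) + 2 * (y * tail y)"
        using Suc.IH[OF y(1,2)] by simp
      also have "\<dots> = (C + 2) * y * tail y" by (simp add: algebra_simps)
      also have "\<dots> \<le> (C + 2) * y * (3/2 * tail x)"
        using u(2)[OF y(1)] y C by (intro mult_left_mono mult_nonneg_nonneg) auto
      also have "\<dots> = (3/4 * (C + 2)) * (x * tail x)" by (simp add: y(3))
      also have "\<dots> \<le> C * (x * tail x)"
        using C y tail_nonneg by (intro mult_right_mono mult_nonneg_nonneg) auto
      finally show ?thesis .
    qed
  qed
  have "truncated_mean x \<le> C * (x * tail x)" if "u \<le> x" for x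
  proof -
    obtain n where "x / (2 * u) < 2 ^ n" using real_arch_pow[of 2] by auto
    then have "x \<le> 2 ^ n * (2 * u)" using u by (simp add: field_simps)
    then show ?thesis using step that by blast
  qed
  then show ?thesis using C u by (intro exI[of _ C] conjI exI[of _ u]) auto
qed

section \<open>The depth scale \<open>ell\<close> as a function of time\<close>

abbreviation trap_scale :: "real \<Rightarrow> real" where
  "trap_scale \<equiv> ell (\<lambda>x. 1 / tail x)"

text \<open>Together with the next lemma this replaces the defining equation of the scale by an
  inequality on either side of the infimum; its attainment does not enter.\<close>

lemma trap_scale_less:
  assumes "0 \<le> t" "trap_scale t < x"
  shows "t * tail x \<le> x"
proof -
  \<comment> \<open>Nonemptiness of the set: \<open>t\<close> itself belongs to it because the tail
    is at most 1.\<close>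
  have "t \<in> {s. 0 \<le> s \<and> t \<le> s * (1 / tail s)}"
    using assms tail_pos[of t] tail_le_1[of t] by (auto simp: field_simps mult_left_le)
  then obtain s where s: "0 \<le> s" "t \<le> s * (1 / tail s)" "s < x"
    using cInf_lessD[of "{s. 0 \<le> s \<and> t \<le> s * (1 / tail s)}" x] assms(2) unfolding ell_def by auto
  have "t * tail x \<le> t * tail s"
    using s assms by (intro mult_left_mono tail_antimono) auto
  also have "\<dots> \<le> s" using s tail_pos[of s] by (simp add: field_simps)
  finally show ?thesis using s by simp
qed

lemma less_trap_scale:
  assumes "0 \<le> x" "x < trap_scale t"
  shows "x < t * tail x"
proof (rule ccontr)
  assume "\<not> x < t * tail x"
  then have "x \<in> {s. 0 \<le> s \<and> t \<le> s * (1 / tail s)}"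
    using assms tail_pos[of x] by (simp add: field_simps)
  then have "trap_scale t \<le> x"
    unfolding ell_def by (intro cInf_lower bdd_belowI[of _ 0]) auto
  with assms show False by simp
qed

lemma trap_scale_at_top: "filterlim trap_scale at_top at_top"
  unfolding filterlim_at_top
proof
  fix x :: real
  define y where "y = max x 1"
  show "\<forall>\<^sub>F t in at_top. x \<le> trap_scale t"
    using eventually_gt_at_top[of "y / tail y"]
  proof eventually_elim
    case (elim t)
    then have "y < t * tail y" using tail_pos[of y] by (simp add: field_simps)
    moreover have "0 \<le> t"
    proof -
      have "0 \<le> y / tail y" using tail_nonneg by (intro divide_nonneg_nonneg) (auto simp: y_def)
      then show ?thesis using elim by linarith
    qed
    ultimately have "\<not> trap_scale t < y" using trap_scale_less[of t y] by linarith
    then show ?case by (simp add: y_def)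
  qed
qed

text \<open>At the scale \<open>l\<close>, time \<open>t\<close> is comparable to
  \<open>l / tail l\<close>. The one-sided inequalities are used at \<open>2 * l\<close> and
  \<open>l / 2\<close>, and slow variation brings both tails back to \<open>l\<close>; each step
  costs a factor 2.\<close>

lemma trap_scale_asymp:
  "\<forall>\<^sub>F t in at_top. t * tail (trap_scale t) \<le> 4 * trap_scale t \<and> trap_scale t \<le> 4 * (t * tail (trap_scale t))"
proof -
  note comp = eventually_compose_filterlim[OF _ trap_scale_at_top]
  have "\<forall>\<^sub>F u in at_top. tail u \<le> 2 * tail (u * 2)" "\<forall>\<^sub>F u in at_top. tail (u * (1/2)) \<le> 2 * tail u"
    by (rule tail_ratio_le; simp)+
  from this[THEN comp] show ?thesis
    using comp[OF eventually_gt_at_top[of 0]] eventually_gt_at_top[of 0]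
  proof eventually_elim
    case (elim t)
    let ?l = "trap_scale t"
    have "t * tail (?l * 2) \<le> ?l * 2" using elim by (intro trap_scale_less) auto
    moreover have "t * tail ?l \<le> t * (2 * tail (?l * 2))"
      using elim by (intro mult_left_mono) auto
    moreover have "?l * (1/2) < t * tail (?l * (1/2))" using elim by (intro less_trap_scale) auto
    moreover have "t * tail (?l * (1/2)) \<le> t * (2 * tail ?l)"
      using elim by (intro mult_left_mono) auto
    ultimately show ?case by simp
  qed
qed

text \<open>The constants are fixed successively: range \<open>R\<close>, separation
  \<open>\<delta>\<close>, depth \<open>K\<close>, shallow total \<open>\<theta>\<close>, cutoff
  \<open>\<eta>\<close>. Each of the four groups of failures receives \<open>d / 4\<close>.\<close>

lemma eventually_good_event:
  assumes "0 < \<rho>" "\<rho> \<le> 1" "0 < d"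
  obtains m a :: "real \<Rightarrow> nat" and \<eta> K \<theta> where "0 < \<theta>" "\<eta> \<le> 1" "1 \<le> K"
    "\<forall>\<^sub>F t in at_top. let l = trap_scale t in
       0 < t \<and> 0 < l \<and> 0 < a t \<and> a t \<le> m t \<and> t / (a t * (K * l)) + \<theta> \<le> \<rho> \<and>
       8 * real (m t) * \<theta> * l / t \<le> \<rho> \<and> 1 - d \<le> prob (good_event (m t) (a t) \<eta> K \<theta> l)"
proof -
  obtain C u where C: "0 < C" "0 < u" "\<And>x. u \<le> x \<Longrightarrow> truncated_mean x \<le> C * (x * tail x)"
    using truncated_mean_bound by blast
  \<comment> \<open>Both sides miss a trap with total probability at most
    \<open>2 * exp (- R)\<close>.\<close>
  define R where "R = max 1 (ln (8 / d))"
  have R: "1 \<le> R" "2 * exp (- R) \<le> d / 4"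
  proof -
    have "exp (- R) \<le> exp (- ln (8 / d))" by (simp add: R_def)
    also have "\<dots> = d / 8" using \<open>0 < d\<close> by (simp add: exp_minus)
    finally show "2 * exp (- R) \<le> d / 4" by simp
  qed (simp add: R_def)
  \<comment> \<open>Two close traps have probability at most \<open>10 * R\<close> times
    \<open>2 * \<delta>\<close>.\<close>
  define \<delta> where "\<delta> = min 1 (d / (80 * R))"
  have \<delta>: "0 < \<delta>" "\<delta> \<le> 1" "20 * R * \<delta> \<le> d / 4"
  proof -
    have "\<delta> * (80 * R) \<le> d"
      unfolding \<delta>_def using R by (subst pos_le_divide_eq[symmetric]) auto
    then show "20 * R * \<delta> \<le> d / 4" by (simp add: mult_ac)
  qed (use R \<open>0 < d\<close> in \<open>auto simp: \<delta>_def\<close>)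
  \<comment> \<open>Escape from a trap costs \<open>t / (a * K * l)\<close>, at most
    \<open>4 / (\<delta> * K)\<close> because \<open>t * tail l \<le> 4 * l\<close>.\<close>
  define K where "K = max 1 (8 / (\<delta> * \<rho>))"
  have K: "1 \<le> K" "4 / (\<delta> * K) \<le> \<rho> / 2"
  proof -
    have "8 \<le> K * (\<delta> * \<rho>)"
      unfolding K_def using \<delta> \<open>0 < \<rho>\<close> by (subst pos_divide_le_eq[symmetric]) auto
    moreover show "1 \<le> K" by (simp add: K_def)
    ultimately show "4 / (\<delta> * K) \<le> \<rho> / 2"
      using \<delta> by (subst pos_divide_le_eq) (simp_all add: mult_ac)
  qed
  \<comment> \<open>The number 64 is 8 from the exit estimate, 2 from rounding \<open>m\<close>, and
    4 from comparing \<open>l\<close> with \<open>t * tail l\<close>.\<close>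
  define \<theta> where "\<theta> = \<rho> / (64 * R)"
  have \<theta>: "0 < \<theta>" "\<theta> \<le> \<rho> / 2" "64 * R * \<theta> \<le> \<rho>"
  proof -
    have "\<theta> * (64 * R) = \<rho>" using R by (simp add: \<theta>_def)
    then show "64 * R * \<theta> \<le> \<rho>" by (simp add: mult_ac)
    have "\<theta> \<le> \<rho> / 2"
      unfolding \<theta>_def using R \<open>0 < \<rho>\<close> by (intro divide_left_mono) auto
    then show "\<theta> \<le> \<rho> / 2" .
  qed (use R \<open>0 < \<rho>\<close> in \<open>simp add: \<theta>_def\<close>)
  \<comment> \<open>Markov's inequality and the truncated mean bound give
    \<open>20 * R * C * \<eta> / \<theta>\<close> for the shallow total.\<close>
  define \<eta> where "\<eta> = min 1 (\<theta> * d / (80 * R * C))"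
  have \<eta>: "0 < \<eta>" "\<eta> \<le> 1" "20 * R * C * \<eta> / \<theta> \<le> d / 4"
  proof -
    have "\<eta> * (80 * R * C) \<le> \<theta> * d"
      unfolding \<eta>_def using R C by (subst pos_le_divide_eq[symmetric]) auto
    then show "20 * R * C * \<eta> / \<theta> \<le> d / 4"
      using \<theta> by (subst pos_divide_le_eq) (simp_all add: mult_ac)
  qed (use R C \<theta> \<open>0 < d\<close> in \<open>auto simp: \<eta>_def\<close>)
  \<comment> \<open>\<open>m\<close> is the range in which both traps are found, \<open>a\<close> the distance kept by other deep traps.\<close>
  define m where "m t = nat \<lceil>R / tail (trap_scale t)\<rceil>" for t
  define a where "a t = nat \<lceil>\<delta> / tail (trap_scale t)\<rceil>" for t
  note comp = eventually_compose_filterlim[OF _ trap_scale_at_top]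
  have ev_diff: "\<forall>\<^sub>F x in at_top. (tail (\<eta> * x) - tail (K * x)) / tail x < d / (40 * R)"
    using R K \<eta> \<open>0 < d\<close> by (intro order_tendstoD(2)[OF tail_difference_ratio_tendsto]) auto
  \<comment> \<open>Makes \<open>\<delta> / tail x\<close> exceed 1, so that rounding up to a
    natural number at most doubles it.\<close>
  have ev_tail: "\<forall>\<^sub>F x in at_top. tail x < \<delta>"
    using order_tendstoD(2)[OF tail_tendsto_0 \<delta>(1)] .
  have two_gt_1: "1 < (2::real)" by simp
  have ev_mean: "\<forall>\<^sub>F x in at_top. truncated_mean (\<eta> * x) \<le> 2 * C * \<eta> * x * tail x"
    using eventually_ge_at_top[of "u / \<eta>"] tail_ratio_le(2)[OF \<eta>(1) two_gt_1]
  proof eventually_elim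
    case (elim x)
    have x: "u \<le> \<eta> * x" using elim(1) \<eta> by (simp add: field_simps)
    then have "truncated_mean (\<eta> * x) \<le> C * (\<eta> * x * tail (\<eta> * x))" by (rule C)
    also have "\<dots> \<le> C * (\<eta> * x * (2 * tail x))"
      using elim(2) x C by (intro mult_left_mono) (auto simp: mult.commute)
    finally show ?case by (simp add: mult_ac)
  qed
  have "\<forall>\<^sub>F t in at_top. let l = trap_scale t in
       0 < t \<and> 0 < l \<and> 0 < a t \<and> a t \<le> m t \<and> t / (a t * (K * l)) + \<theta> \<le> \<rho> \<and>
       8 * real (m t) * \<theta> * l / t \<le> \<rho> \<and> 1 - d \<le> prob (good_event (m t) (a t) \<eta> K \<theta> l)"
    using comp[OF ev_diff] comp[OF ev_tail] comp[OF ev_mean] comp[OF eventually_gt_at_top[of 0]]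
      trap_scale_asymp eventually_gt_at_top[of 0]
  proof eventually_elim
    case (elim t)
    define l where "l = trap_scale t"
    define p where "p = tail l"
    have l: "0 < l" and t: "0 < t" and p: "0 < p" "p < \<delta>" "p \<le> 1"
      and diff: "(tail (\<eta> * l) - tail (K * l)) / p < d / (40 * R)"
      and mean: "truncated_mean (\<eta> * l) \<le> 2 * C * \<eta> * l * p"
      and tl: "t * p \<le> 4 * l" "l \<le> 4 * (t * p)"
      using elim tail_pos \<delta> by (auto simp: l_def p_def)
    have m: "R / p \<le> real (m t)" "real (m t) \<le> 2 * R / p"
    proof -
      show "R / p \<le> real (m t)" unfolding m_def l_def[symmetric] p_def[symmetric] by linarith
      have "real (m t) \<le> R / p + 1"
        unfolding m_def l_def[symmetric] p_def[symmetric] using R p by (simp add: of_nat_nat)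
      also have "\<dots> \<le> R / p + R / p" using R p by (simp add: field_simps)
      finally show "real (m t) \<le> 2 * R / p" by simp
    qed
    have a: "\<delta> / p \<le> real (a t)" "real (a t) \<le> 2 * \<delta> / p"
    proof -
      show "\<delta> / p \<le> real (a t)" unfolding a_def l_def[symmetric] p_def[symmetric] by linarith
      have "real (a t) \<le> \<delta> / p + 1"
        unfolding a_def l_def[symmetric] p_def[symmetric] using \<delta> p by (simp add: of_nat_nat)
      also have "\<dots> \<le> \<delta> / p + \<delta> / p" using \<delta> p by (simp add: field_simps)
      finally show "real (a t) \<le> 2 * \<delta> / p" by simp
    qed
    have a0: "0 < real (a t)" using a(1) \<delta> p by (smt (verit) divide_pos_pos)
    have am: "a t \<le> m t"
    proof -
      have "\<delta> / p \<le> R / p" using \<delta> R p by (intro divide_right_mono) auto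
      then show ?thesis unfolding a_def m_def l_def[symmetric] p_def[symmetric] by (intro nat_mono ceiling_mono)
    qed
    have 1: "t / (a t * (K * l)) + \<theta> \<le> \<rho>"
    proof -
      have "t / (a t * (K * l)) \<le> t / (\<delta> / p * (K * l))"
        using a a0 \<delta> p K l t by (intro divide_left_mono mult_right_mono mult_pos_pos divide_pos_pos) auto
      also have "\<dots> = (t * p) / (\<delta> * (K * l))" by simp
      also have "\<dots> \<le> (4 * l) / (\<delta> * (K * l))"
        using tl \<delta> K l by (intro divide_right_mono mult_nonneg_nonneg) auto
      also have "\<dots> = 4 / (\<delta> * K)" using l by simp
      finally show ?thesis using K \<theta> by linarith
    qed
    have 2: "8 * real (m t) * \<theta> * l / t \<le> \<rho>"
    proof -
      have "8 * real (m t) * \<theta> * l / t \<le> 8 * (2 * R / p) * \<theta> * (4 * (t * p)) / t"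
        using m tl \<theta> t l R p by (intro divide_right_mono mult_mono mult_nonneg_nonneg) auto
      also have "\<dots> = 64 * R * \<theta>" using p t by simp
      finally show ?thesis using \<theta> by linarith
    qed
    have c: "real (4 * m t + 1) \<le> 10 * R / p"
    proof -
      have "1 \<le> R / p" using R p by (simp add: field_simps)
      then show ?thesis using m by simp
    qed
    have 3: "2 * exp (- (m t * tail l)) \<le> d / 4"
    proof -
      have "R \<le> m t * tail l" using m(1) p by (simp add: field_simps p_def)
      then have "exp (- (m t * tail l)) \<le> exp (- R)" by simp
      then show ?thesis using R by linarith
    qed
    have 4: "real (4 * m t + 1) * (tail (\<eta> * l) - tail (K * l)) \<le> d / 4"
    proof -
      have "tail (K * l) \<le> tail (\<eta> * l)"
        using \<eta> K l by (intro tail_antimono mult_right_mono) auto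
      then have "real (4 * m t + 1) * (tail (\<eta> * l) - tail (K * l)) \<le> 10 * R / p * (tail (\<eta> * l) - tail (K * l))"
        by (intro mult_right_mono c) auto
      also have "\<dots> = 10 * R * ((tail (\<eta> * l) - tail (K * l)) / p)" by simp
      also have "\<dots> \<le> 10 * R * (d / (40 * R))"
        using diff R by (intro mult_left_mono) auto
      also have "\<dots> = d / 4" using R by simp
      finally show ?thesis .
    qed
    have 5: "real (4 * m t + 1) * truncated_mean (\<eta> * l) / (\<theta> * l) \<le> d / 4"
    proof -
      have "real (4 * m t + 1) * truncated_mean (\<eta> * l) \<le> real (4 * m t + 1) * (2 * C * \<eta> * l * p)"
        using mean by (intro mult_left_mono) auto
      also have "\<dots> \<le> 10 * R / p * (2 * C * \<eta> * l * p)"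
        using C \<eta> l p by (intro mult_right_mono c) auto
      finally have "real (4 * m t + 1) * truncated_mean (\<eta> * l) / (\<theta> * l) \<le> 10 * R / p * (2 * C * \<eta> * l * p) / (\<theta> * l)"
        using \<theta> l by (intro divide_right_mono) auto
      also have "\<dots> = 20 * R * C * \<eta> / \<theta>" using p l by simp
      finally show ?thesis using \<eta> by linarith
    qed
    have 6: "real ((4 * m t + 1) * a t) * (tail l * tail l) \<le> d / 4"
    proof -
      have "real (4 * m t + 1) * real (a t) * (p * p) \<le> (10 * R / p) * (2 * \<delta> / p) * (p * p)"
        using c a R p by (intro mult_right_mono mult_mono) auto
      also have "\<dots> = 20 * R * \<delta>" using p by simp
      finally have "real (4 * m t + 1) * real (a t) * (tail l * tail l) \<le> d / 4"
        using \<delta> unfolding p_def by linarith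
      then show ?thesis by (simp only: of_nat_mult)
    qed
    have "1 - d \<le> prob (good_event (m t) (a t) \<eta> K \<theta> l)"
    proof -
      have "0 < m t" "\<eta> \<le> K" using a0 am \<eta> K by auto
      from prob_good_event[OF this(1) l \<theta>(1) this(2), of "a t"] 3 4 5 6 show ?thesis by linarith
    qed
    then show ?case
      unfolding Let_def l_def[symmetric] using 1 2 l t a0 am by simp
  qed
  with \<theta> \<eta> K that show thesis by blast
qed

end

section \<open>Convergence in probability\<close>

theorem theorem1p2:
  fixes M :: "'a measure" and \<sigma> :: "'a \<Rightarrow> int \<Rightarrow> real" and L :: "real \<Rightarrow> real"
    and i :: nat
  assumes "prob_space M"
    and "prob_space.indep_vars M (\<lambda>_. borel) (\<lambda>z \<omega>. \<sigma> \<omega> z) UNIV"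
    and "\<And>z. distr M borel (\<lambda>\<omega>. \<sigma> \<omega> z) = distr M borel (\<lambda>\<omega>. \<sigma> \<omega> 0)"
    and "\<And>\<omega> z. 0 < \<sigma> \<omega> z"
    and "\<And>x. L x = 1 / measure M {\<omega> \<in> space M. x < \<sigma> \<omega> 0}"
    and "slowly_varying L"
    and "i \<in> {1, 2}"
  shows "conv_in_prob M
           (\<lambda>t \<omega>. let l = ell L t; Z = (if i = 1 then Z1 (\<sigma> \<omega>) l else Z2 (\<sigma> \<omega>) l) in
              BTM_prob (\<sigma> \<omega>) t Z + real_of_int \<bar>Z\<bar> / real_of_int (\<Sum>z\<in>Gamma_set (\<sigma> \<omega>) l. \<bar>z\<bar>))
           1"
proof -
  interpret iid_traps M \<sigma>
    by (intro iid_traps.intro iid_traps_axioms.intro assms)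
  have L: "L = (\<lambda>x. 1 / tail x)"
    using assms(5) by (simp add: tail_def fun_eq_iff)
  interpret slowly_varying_traps M \<sigma>
    by unfold_locales (use assms(6) L in simp)
  show ?thesis
    unfolding conv_in_prob_def
  proof (intro allI impI)
    fix \<epsilon> d :: real
    assume "0 < \<epsilon>" "0 < d"
    \<comment> \<open>The two-trap estimate has error \<open>2 * \<rho>\<close> and requires
      \<open>\<rho> \<le> 1\<close>.\<close>
    define \<rho> where "\<rho> = min 1 (\<epsilon> / 2)"
    have \<rho>: "0 < \<rho>" "\<rho> \<le> 1" "2 * \<rho> \<le> \<epsilon>" using \<open>0 < \<epsilon>\<close> by (auto simp: \<rho>_def)
    obtain m a \<eta> K \<theta> where const: "0 < \<theta>" "\<eta> \<le> 1" "1 \<le> K" and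
      ev: "\<forall>\<^sub>F t in at_top. let l = trap_scale t in
       0 < t \<and> 0 < l \<and> 0 < a t \<and> a t \<le> m t \<and> t / (a t * (K * l)) + \<theta> \<le> \<rho> \<and>
       8 * real (m t) * \<theta> * l / t \<le> \<rho> \<and> 1 - d \<le> prob (good_event (m t) (a t) \<eta> K \<theta> l)"
      by (rule eventually_good_event[OF \<rho>(1,2) \<open>0 < d\<close>])
    show "\<forall>\<^sub>F t in at_top. \<exists>A\<in>events. 1 - d \<le> prob A \<and> (\<forall>\<omega>\<in>A.
      \<bar>(let l = ell L t; Z = (if i = 1 then Z1 (\<sigma> \<omega>) l else Z2 (\<sigma> \<omega>) l) in
          BTM_prob (\<sigma> \<omega>) t Z + real_of_int \<bar>Z\<bar> / real_of_int (\<Sum>z\<in>Gamma_set (\<sigma> \<omega>) l. \<bar>z\<bar>)) - 1\<bar> \<le> \<epsilon>)"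
      using ev
    proof eventually_elim
      case (elim t)
      define l where "l = trap_scale t"
      have t: "0 < t" and l: "0 < l" and am: "0 < a t" "a t \<le> m t"
        and bounds: "t / (a t * (K * l)) + \<theta> \<le> \<rho>" "8 * real (m t) * \<theta> * l / t \<le> \<rho>"
        and pr: "1 - d \<le> prob (good_event (m t) (a t) \<eta> K \<theta> l)"
        using elim by (simp_all add: Let_def l_def)
      show ?case
      proof (intro bexI[OF _ good_event_measurable] conjI ballI)
        show "1 - d \<le> prob (good_event (m t) (a t) \<eta> K \<theta> l)" by (rule pr)
        fix \<omega> assume \<omega>: "\<omega> \<in> good_event (m t) (a t) \<eta> K \<theta> l"
        interpret landscape "\<sigma> \<omega>" by standard (rule positive)
        \<comment> \<open>Turns separation by distances \<open>d\<close> back into separation of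
          pairs of sites.\<close>
        have apart: "\<sigma> \<omega> y \<le> l"
          if "x \<in> {-2 * int (m t)..2 * int (m t)}" "x < y" "y - x \<le> int (a t)" "l < \<sigma> \<omega> x" for x y
        proof -
          have "nat (y - x) \<in> {1..a t}" using that by auto
          then have "\<not> (l < \<sigma> \<omega> x \<and> l < \<sigma> \<omega> (x + int (nat (y - x))))"
            using \<omega> that(1) unfolding good_event_def by blast
          then show ?thesis using that by simp
        qed
        have bound: "\<bar>BTM_prob (\<sigma> \<omega>) t Z + real_of_int \<bar>Z\<bar> / real_of_int (\<Sum>z\<in>Gamma_set (\<sigma> \<omega>) l. \<bar>z\<bar>) - 1\<bar> \<le> 2 * \<rho>"
          if "Z \<in> Gamma_set (\<sigma> \<omega>) l" for Z
        proof (rule BTM_prob_good_environment[OF l am const(2,3,1) t])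
          show "\<sigma> \<omega> y \<le> l"
            if "x \<in> {-2 * int (m t)..2 * int (m t)}" "x < y" "y - x \<le> int (a t)" "l < \<sigma> \<omega> x" for x y
            by (rule apart[OF that])
        qed (use \<omega> bounds \<rho> that in \<open>auto simp: good_event_def\<close>)
        define Z where "Z = (if i = 1 then Z1 (\<sigma> \<omega>) l else Z2 (\<sigma> \<omega>) l)"
        have "Z \<in> Gamma_set (\<sigma> \<omega>) l" by (simp add: Z_def Gamma_set_def)
        from bound[OF this] \<rho>(3)
        show "\<bar>(let l = ell L t; Z = (if i = 1 then Z1 (\<sigma> \<omega>) l else Z2 (\<sigma> \<omega>) l) in
          BTM_prob (\<sigma> \<omega>) t Z + real_of_int \<bar>Z\<bar> / real_of_int (\<Sum>z\<in>Gamma_set (\<sigma> \<omega>) l. \<bar>z\<bar>)) - 1\<bar> \<le> \<epsilon>"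
          unfolding L Let_def l_def[symmetric] Z_def[symmetric] by (rule order_trans)
      qed
    qed
  qed
qed

end
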